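(* For all $\lambda,\mu,\nu\in\mathcal{P}_d$, $$c_{\lambda,\mu}^{\nu}=\sum_{L\in\mathcal{LR}_{\lambda,\mu}^{\nu\,+}} c_L .$$
   Context: Fix a positive integer $d$. $\mathbb{N}$ is the set of nonnegative integers; for an integer $m$, $m':=d+1-m$. $\mathcal{P}_d$ is the set of partitions $\lambda=(\lambda_1\geq\cdots\geq\lambda_d)\in\mathbb{N}^d$. For a finite sequence with terms in $\{1,\ldots,d\}$, its content is $\omega=(\xi_1,\ldots,\xi_d)\in\mathbb{N}^d$, where $\xi_k$ is the number of $k$'s in the sequence. Reverse diagrams and factorial Schur functions. To $\mu\in\mathcal{P}_d$ associate its reverse Young diagram, the right- and bottom-justified array of boxes whose bottom row has length $\mu_1$, next-to-bottom row length $\mu_2$, etc. Rows are numbered $1,2,\ldots$ from bottom to top and columns $1,2,\ldots$ from right to left; $r(a)$ and $c(a)$ are the row and column numbers of (the box of) an entry $a$. A reverse tableau of shape $\mu$ is a filling of the boxes by integers in $\{1,\ldots,d\}$ weakly increasing along rows from left to right and strictly increasing down columns from top to bottom; $\mathcal{R}(\mu)$ is the set of these. With variables $x_1,\ldots,x_d$ and $(y_i)_{i\geq1}$, the factorial Schur function is $s_\mu(x\,|\,y)=\sum_{R\in\mathcal{R}(\mu)}\prod_{a\in R}(x_a-y_{a'+c(a)-r(a)})$. The $s_\nu(x\,|\,y)$, $\nu\in\mathcal{P}_d$, form a $\mathbb{C}[y_i]$-basis of $\mathbb{C}[y_i][x_1,\ldots,x_d]^{S_d}$, and $c_{\lambda,\mu}^{\nu}\in\mathbb{C}[y_i]$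 are defined by $s_\lambda(x\,|\,y)s_\mu(x\,|\,y)=\sum_{\nu\in\mathcal{P}_d}c_{\lambda,\mu}^{\nu}s_\nu(x\,|\,y)$. Skew barred tableaux. The skew diagram $\lambda*\mu$ is obtained by placing the ordinary (top-left justified) Young diagram $\lambda$ above and to the right of the reverse Young diagram $\mu$ (so no box of $\lambda$ shares a row or column with a box of $\mu$). A skew barred tableau $L$ of shape $\lambda*\mu$ fills each box of $\lambda$ with an element of $\{1,\ldots,d\}$ and each box of $\mu$ with an element of $\{1,\ldots,d\}\cup\{\bar1,\ldots,\bar d\}$ so that the values, disregarding bars, weakly increase along rows from left to right and strictly increase down columns. $|a|$ denotes the integer value of an entry $a$ (bar disregarded). The unbarred column word $L^u$ is the sequence of unbarred entries of $L$ read column by column, starting with the rightmost column and moving left, each column read from top to bottom, barred entries being skipped. It is Yamanouchi if every initial segment contains at least as many $k$'s as $(k+1)$'s for each $k=1,\ldots,d-1$. $\mathcal{LR}_{\lambda,\mu}^{\nu}$ is the set of skew barred tableaux of shape $\lambda*\mu$ whose unbarred column word is Yamanouchi with $\omega(L^u)=\nu$. For $a\in L$, $L^u_{<a}$ is the portion of the unbarred column word that comes before reaching $a$ in the reading order. Set $$c_L=\prod_{a\in L,\ a\text{ barred}}\left(y_{|a|'+\omega(L^u_{<a})_{|a|}}-y_{|a|'+c(a)-r(a)}\right)$$ ($r(a),c(a)$ the row and column numbers of $a$ in the reverse diagram $\mu$; empty product $=1$). We write $c_L>0$ if each factor in this product is of the form $y_i-y_j$ with $i>j$. $\mathcal{LR}_{\lambda,\mu}^{\nu\,+}$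 is the set of $L\in\mathcal{LR}_{\lambda,\mu}^{\nu}$ with $c_L>0$. *)

theory Defs
  imports Complex_Main "HOL-Library.Poly_Mapping" "HOL-Library.FuncSet"
begin

text \<open>
  Multivariate polynomials are finitely supported functions from monomials
  (exponent vectors \<open>nat \<Rightarrow>\<^sub>0 nat\<close>) to coefficients, with the convolution product of
  \<^theory>\<open>HOL-Library.Poly_Mapping\<close>. The variables \<open>x\<^sub>0\<close> and \<open>y\<^sub>0\<close>, which these types also
  provide, do not occur in any of the polynomials below.
\<close>

type_synonym 'a mpol = "(nat \<Rightarrow>\<^sub>0 nat) \<Rightarrow>\<^sub>0 'a"
type_synonym ypol = "complex mpol"
type_synonym xypol = "ypol mpol"

definition Var :: "nat \<Rightarrow> 'a::comm_ring_1 mpol"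
  where "Var i = Poly_Mapping.single (Poly_Mapping.single i 1) 1"

definition Const :: "'a::comm_ring_1 \<Rightarrow> 'a mpol"
  where "Const c = Poly_Mapping.single 0 c"

text \<open>
  Partitions are functions on \<open>{1..d}\<close>, extended by \<open>0\<close>; so are contents of words.
\<close>

definition partitions :: "nat \<Rightarrow> (nat \<Rightarrow> nat) set"
  where "partitions d = {la. (\<forall>i. i \<notin> {1..d} \<longrightarrow> la i = 0) \<and>
                             (\<forall>i j. 1 \<le> i \<and> i \<le> j \<and> j \<le> d \<longrightarrow> la j \<le> la i)}"

definition content :: "nat list \<Rightarrow> nat \<Rightarrow> nat"
  where "content w = (\<lambda>k. count_list w k)"

definition compl_index :: "nat \<Rightarrow> nat \<Rightarrow> nat"
  where "compl_index d m = d + 1 - m"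

text \<open>
  The same index set serves the Young diagram and the reverse Young diagram of a partition.
  In the former, rows are counted from the top and columns from the left; in the latter,
  rows are counted from the bottom and columns from the right. Fillings are extensional
  functions on the boxes.
\<close>

definition boxes :: "nat \<Rightarrow> (nat \<Rightarrow> nat) \<Rightarrow> (nat \<times> nat) set"
  where "boxes d la = {(r, c). r \<in> {1..d} \<and> c \<in> {1..la r}}"

definition tableau_cond :: "nat \<Rightarrow> (nat \<Rightarrow> nat) \<Rightarrow> (nat \<times> nat \<Rightarrow> nat) \<Rightarrow> bool"
  where "tableau_cond d la T \<longleftrightarrow>
    (\<forall>r c c'. (r, c) \<in> boxes d la \<and> (r, c') \<in> boxes d la \<and> c < c' \<longrightarrow> T (r, c) \<le> T (r, c')) \<and>
    (\<forall>r r' c. (r, c) \<in> boxes d la \<and> (r', c) \<in> boxes d la \<and> r < r' \<longrightarrow> T (r, c) < T (r', c))"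

definition reverse_tableau_cond :: "nat \<Rightarrow> (nat \<Rightarrow> nat) \<Rightarrow> (nat \<times> nat \<Rightarrow> nat) \<Rightarrow> bool"
  where "reverse_tableau_cond d mu R \<longleftrightarrow>
    (\<forall>r c c'. (r, c) \<in> boxes d mu \<and> (r, c') \<in> boxes d mu \<and> c < c' \<longrightarrow> R (r, c') \<le> R (r, c)) \<and>
    (\<forall>r r' c. (r, c) \<in> boxes d mu \<and> (r', c) \<in> boxes d mu \<and> r < r' \<longrightarrow> R (r', c) < R (r, c))"

definition reverse_tableaux :: "nat \<Rightarrow> (nat \<Rightarrow> nat) \<Rightarrow> (nat \<times> nat \<Rightarrow> nat) set"
  where "reverse_tableaux d mu = {R \<in> boxes d mu \<rightarrow>\<^sub>E {1..d}. reverse_tableau_cond d mu R}"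

text \<open>
  Column strictness forces the entry \<open>a\<close> in row \<open>r\<close> of a reverse tableau to satisfy
  \<open>compl_index d a \<ge> r\<close>, so the subtraction in the index of \<open>y\<close> does not truncate and the
  index is at least \<open>1\<close>. The same holds for the weight \<open>c\<^sub>L\<close> further below.
\<close>

definition factorial_schur :: "nat \<Rightarrow> (nat \<Rightarrow> nat) \<Rightarrow> xypol"
  where "factorial_schur d mu =
    (\<Sum>R\<in>reverse_tableaux d mu. \<Prod>(r, c)\<in>boxes d mu.
       Var (R (r, c)) - Const (Var (compl_index d (R (r, c)) + c - r)))"

text \<open>
  The structure constants are the coordinates of the product in the basis of factorial Schur
  functions, i.e. the unique finitely supported family in \<open>\<complex>[y]\<close>, indexed by
  partitions, with the expansion property below.
\<close>

definition structure_const ::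
    "nat \<Rightarrow> (nat \<Rightarrow> nat) \<Rightarrow> (nat \<Rightarrow> nat) \<Rightarrow> (nat \<Rightarrow> nat) \<Rightarrow> ypol"
  where "structure_const d la mu =
    Poly_Mapping.lookup
      (THE c :: (nat \<Rightarrow> nat) \<Rightarrow>\<^sub>0 ypol.
         Poly_Mapping.keys c \<subseteq> partitions d \<and>
         factorial_schur d la * factorial_schur d mu =
           (\<Sum>nu\<in>Poly_Mapping.keys c.
              Const (Poly_Mapping.lookup c nu) * factorial_schur d nu))"

datatype entry = Unbarred nat | Barred nat

primrec entry_val :: "entry \<Rightarrow> nat" where
  "entry_val (Unbarred k) = k"
| "entry_val (Barred k) = k"

primrec is_barred :: "entry \<Rightarrow> bool" where
  "is_barred (Unbarred k) = False"
| "is_barred (Barred k) = True"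

text \<open>
  No box of \<open>\<lambda>\<close> shares a row or a column with a box of \<open>\<mu>\<close> in the skew diagram
  \<open>\<lambda> * \<mu>\<close>, so a filling of it is a pair of a filling of the Young diagram of \<open>\<lambda>\<close> and a
  filling of the reverse Young diagram of \<open>\<mu>\<close>, subject to separate monotonicity conditions.
\<close>

type_synonym skew_filling = "(nat \<times> nat \<Rightarrow> nat) \<times> (nat \<times> nat \<Rightarrow> entry)"

definition skew_barred_tableaux :: "nat \<Rightarrow> (nat \<Rightarrow> nat) \<Rightarrow> (nat \<Rightarrow> nat) \<Rightarrow> skew_filling set"
  where "skew_barred_tableaux d la mu =
    {(T, U). T \<in> boxes d la \<rightarrow>\<^sub>E {1..d} \<and> tableau_cond d la T \<and>
             U \<in> boxes d mu \<rightarrow>\<^sub>E (Unbarred ` {1..d} \<union> Barred ` {1..d}) \<and>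
             reverse_tableau_cond d mu (entry_val \<circ> U)}"

text \<open>
  Boxes in reading order: columns from right to left, each from top to bottom. All of
  \<open>\<lambda>\<close> is read before \<open>\<mu>\<close>.
\<close>

definition young_reading :: "nat \<Rightarrow> (nat \<Rightarrow> nat) \<Rightarrow> (nat \<times> nat) list"
  where "young_reading d la = [(i, j). j \<leftarrow> rev [1..<la 1 + 1], i \<leftarrow> [1..<d + 1], j \<le> la i]"

definition reverse_reading :: "nat \<Rightarrow> (nat \<Rightarrow> nat) \<Rightarrow> (nat \<times> nat) list"
  where "reverse_reading d mu = [(r, c). c \<leftarrow> [1..<mu 1 + 1], r \<leftarrow> rev [1..<d + 1], c \<le> mu r]"

definition unbarred_entries :: "(nat \<times> nat \<Rightarrow> entry) \<Rightarrow> (nat \<times> nat) list \<Rightarrow> nat list"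
  where "unbarred_entries U bs = map entry_val (filter (\<lambda>e. \<not> is_barred e) (map U bs))"

definition unbarred_word :: "nat \<Rightarrow> (nat \<Rightarrow> nat) \<Rightarrow> (nat \<Rightarrow> nat) \<Rightarrow> skew_filling \<Rightarrow> nat list"
  where "unbarred_word d la mu = (\<lambda>(T, U).
    map T (young_reading d la) @ unbarred_entries U (reverse_reading d mu))"

text \<open>The portion of the unbarred column word before the box \<open>b\<close> of \<open>\<mu>\<close>.\<close>

definition unbarred_word_before ::
    "nat \<Rightarrow> (nat \<Rightarrow> nat) \<Rightarrow> (nat \<Rightarrow> nat) \<Rightarrow> skew_filling \<Rightarrow> nat \<times> nat \<Rightarrow> nat list"
  where "unbarred_word_before d la mu = (\<lambda>(T, U) b.
    map T (young_reading d la) @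
    unbarred_entries U (takeWhile (\<lambda>b'. b' \<noteq> b) (reverse_reading d mu)))"

definition yamanouchi :: "nat \<Rightarrow> nat list \<Rightarrow> bool"
  where "yamanouchi d w \<longleftrightarrow>
    (\<forall>n \<le> length w. \<forall>k. 1 \<le> k \<and> k < d \<longrightarrow> content (take n w) (k + 1) \<le> content (take n w) k)"

definition LR :: "nat \<Rightarrow> (nat \<Rightarrow> nat) \<Rightarrow> (nat \<Rightarrow> nat) \<Rightarrow> (nat \<Rightarrow> nat) \<Rightarrow> skew_filling set"
  where "LR d la mu nu =
    {L \<in> skew_barred_tableaux d la mu.
       yamanouchi d (unbarred_word d la mu L) \<and> content (unbarred_word d la mu L) = nu}"

definition barred_boxes :: "nat \<Rightarrow> (nat \<Rightarrow> nat) \<Rightarrow> skew_filling \<Rightarrow> (nat \<times> nat) set"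
  where "barred_boxes d mu L = {b \<in> boxes d mu. is_barred (snd L b)}"

definition weight_factor ::
    "nat \<Rightarrow> (nat \<Rightarrow> nat) \<Rightarrow> (nat \<Rightarrow> nat) \<Rightarrow> skew_filling \<Rightarrow> nat \<times> nat \<Rightarrow> ypol"
  where "weight_factor d la mu L = (\<lambda>(r, c).
    let a = entry_val (snd L (r, c)) in
      Var (compl_index d a + content (unbarred_word_before d la mu L (r, c)) a)
      - Var (compl_index d a + c - r))"

definition weight :: "nat \<Rightarrow> (nat \<Rightarrow> nat) \<Rightarrow> (nat \<Rightarrow> nat) \<Rightarrow> skew_filling \<Rightarrow> ypol"
  where "weight d la mu L = (\<Prod>b\<in>barred_boxes d mu L. weight_factor d la mu L b)"

definition weight_pos :: "nat \<Rightarrow> (nat \<Rightarrow> nat) \<Rightarrow> (nat \<Rightarrow> nat) \<Rightarrow> skew_filling \<Rightarrow> bool"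
  where "weight_pos d la mu L \<longleftrightarrow>
    (\<forall>b\<in>barred_boxes d mu L. \<exists>i j. i > j \<and> weight_factor d la mu L b = Var i - Var j)"

definition LR_pos :: "nat \<Rightarrow> (nat \<Rightarrow> nat) \<Rightarrow> (nat \<Rightarrow> nat) \<Rightarrow> (nat \<Rightarrow> nat) \<Rightarrow> skew_filling set"
  where "LR_pos d la mu nu = {L \<in> LR d la mu nu. weight_pos d la mu L}"

end

theory Submission
  imports Defs "HOL-Combinatorics.Permutations"
begin

text \<open>
  After Stembridge's proof of the Littlewood--Richardson rule. Multiplying a falling
  product \<open>(x - y\<^sub>1) \<dots> (x - y\<^sub>n)\<close> by \<open>x - y\<^sub>j\<close> either raises its length (an unbarred entry) or
  produces the scalar \<open>y\<close> of index \<open>n + 1\<close> minus \<open>y\<^sub>j\<close> (a barred entry). Expanding the product of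
  the alternant of \<open>\<lambda> + \<rho>\<close> with \<open>s\<^sub>\<mu>\<close> box by box in reading order gives the sum of all \<open>c\<^sub>L\<close> times
  alternants. As soon as the word read so far violates the Yamanouchi condition at \<open>k\<close>, two
  exponents coincide while the sum over the unread boxes is symmetric in \<open>x\<^sub>k\<close> and the next
  variable, so the antisymmetrization vanishes. A tableau with a non-positive factor also has a
  factor equal to zero in the same row. For \<open>\<lambda> = 0\<close> only one tableau
  survives, which is the bialternant formula; together with the linear independence of the
  alternants it turns the expansion into one in factorial Schur functions.
\<close>

subsection \<open>Partial sums over reverse tableaux and adjacent transpositions\<close>

text \<open>The obstacle is the symmetry of the sums over unread boxes. The Bender-Knuth exchange of
  \<open>k\<close> and \<open>k + 1\<close> does not preserve their terms, because the index of
  \<open>y\<close> in a factor depends on the entry as well as on its place. What can be used is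
  that \<open>a' + c - r\<close> grows by one when the entry drops by one, when the box moves one
  column to the left and when it moves one row down. So a \<open>k\<close> has the same
  \<open>y\<close> as a \<open>k + 1\<close> directly below it or in the next box to the left. This
  suffices to prove symmetry by induction over the unread columns, provided that the entries of the
  last read column are carried along as a bound.

  Symmetry of the factorial Schur functions and existence of the structure constants are not
  presupposed. The former is the case in which no box has been read; the latter comes out of the
  expansion.

  Polynomials in \<open>x\<close> are treated as functions of a point \<open>x\<close> with values
  in any domain of characteristic 0, so that permutations act by composition. Only at the end does
  the point become the tuple of variables \<open>Var\<close>, with values in
  \<open>xypol\<close>.\<close>

definition swap_invariant :: "nat \<Rightarrow> ((nat \<Rightarrow> 'a) \<Rightarrow> 'b) \<Rightarrow> bool"
  where "swap_invariant k f \<longleftrightarrow> (\<forall>x. f (x \<circ> transpose k (Suc k)) = f x)"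

lemma swap_invariantD: "swap_invariant k f \<Longrightarrow> f (x \<circ> transpose k (Suc k)) = f x"
  by (simp add: swap_invariant_def)

lemma swap_invariant_sum:
  "(\<And>i. i \<in> S \<Longrightarrow> swap_invariant k (f i)) \<Longrightarrow> swap_invariant k (\<lambda>x. \<Sum>i\<in>S. f i x)"
  by (simp add: swap_invariant_def)

lemma swap_invariant_prod:
  "(\<And>i. i \<in> S \<Longrightarrow> swap_invariant k (f i)) \<Longrightarrow> swap_invariant k (\<lambda>x. \<Prod>i\<in>S. f i x)"
  by (simp add: swap_invariant_def)

lemma swap_invariant_mult:
  "swap_invariant k f \<Longrightarrow> swap_invariant k g \<Longrightarrow> swap_invariant k (\<lambda>x. f x * g x)"
  by (simp add: swap_invariant_def)

lemma swap_invariant_add: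
  "swap_invariant k f \<Longrightarrow> swap_invariant k g \<Longrightarrow> swap_invariant k (\<lambda>x. f x + g x)"
  by (simp add: swap_invariant_def)

lemma swap_invariant_diff:
  fixes f g :: "(nat \<Rightarrow> 'a) \<Rightarrow> 'b::ab_group_add"
  shows "swap_invariant k f \<Longrightarrow> swap_invariant k g \<Longrightarrow> swap_invariant k (\<lambda>x. f x - g x)"
  by (simp add: swap_invariant_def)

lemma swap_invariant_cong:
  "(\<And>x. f x = g x) \<Longrightarrow> swap_invariant k g \<Longrightarrow> swap_invariant k f"
  by (simp add: swap_invariant_def)

section \<open>Shapes, blocks of columns, and fillings of blocks\<close>

locale shape =
  fixes d :: nat and mu :: "nat \<Rightarrow> nat" and y :: "nat \<Rightarrow> 'a::{idom,ring_char_0}"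
  assumes mu: "mu \<in> partitions d"
begin

lemma box_iff: "(r, c) \<in> boxes d mu \<longleftrightarrow> 1 \<le> r \<and> r \<le> d \<and> 1 \<le> c \<and> c \<le> mu r"
  by (auto simp: boxes_def)

lemma mu_antimono: "1 \<le> i \<Longrightarrow> i \<le> j \<Longrightarrow> j \<le> d \<Longrightarrow> mu j \<le> mu i"
  using mu by (auto simp: partitions_def)

lemma box_mono: "(r, c) \<in> boxes d mu \<Longrightarrow> 1 \<le> r' \<Longrightarrow> r' \<le> r \<Longrightarrow> 1 \<le> c' \<Longrightarrow> c' \<le> c \<Longrightarrow> (r', c') \<in> boxes d mu"
  using mu_antimono[of r' r] by (auto simp: box_iff)

lemma box_le_width: "(r, c) \<in> boxes d mu \<Longrightarrow> c \<le> mu 1"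
  using box_mono[of r c 1 c] by (auto simp: box_iff)

lemma finite_boxes: "finite (boxes d mu)"
proof (rule finite_subset)
  show "boxes d mu \<subseteq> {1..d} \<times> {1..mu 1}"
    using box_le_width by (force simp: box_iff)
qed auto

definition block :: "nat \<Rightarrow> nat \<Rightarrow> (nat \<times> nat) set"
  where "block a b = {(r, c). (r, c) \<in> boxes d mu \<and> a < c \<and> c \<le> b}"

lemma block_iff: "(r, c) \<in> block a b \<longleftrightarrow> (r, c) \<in> boxes d mu \<and> a < c \<and> c \<le> b"
  by (simp add: block_def)

lemma block_subset: "block a b \<subseteq> boxes d mu"
  by (auto simp: block_def)

lemma finite_block [simp]: "finite (block a b)"
  using finite_subset[OF block_subset finite_boxes] .

lemma block_all: "block 0 (mu 1) = boxes d mu"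
  using box_le_width by (auto simp: block_def) (auto simp: box_iff)

definition reverse_valid :: "(nat \<times> nat) set \<Rightarrow> (nat \<times> nat \<Rightarrow> nat) \<Rightarrow> bool"
  where "reverse_valid S R \<longleftrightarrow>
    (\<forall>r c c'. (r, c) \<in> S \<and> (r, c') \<in> S \<and> c < c' \<longrightarrow> R (r, c') \<le> R (r, c)) \<and>
    (\<forall>r r' c. (r, c) \<in> S \<and> (r', c) \<in> S \<and> r < r' \<longrightarrow> R (r', c) < R (r, c))"

lemma reverse_valid_boxes: "reverse_valid (boxes d mu) R \<longleftrightarrow> reverse_tableau_cond d mu R"
  by (simp add: reverse_valid_def reverse_tableau_cond_def)

lemma reverse_valid_row: "reverse_valid S R \<Longrightarrow> (r, c) \<in> S \<Longrightarrow> (r, c') \<in> S \<Longrightarrow> c \<le> c' \<Longrightarrow> R (r, c') \<le> R (r, c)"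
  by (cases "c = c'") (auto simp: reverse_valid_def)

lemma reverse_valid_col: "reverse_valid S R \<Longrightarrow> (r, c) \<in> S \<Longrightarrow> (r', c) \<in> S \<Longrightarrow> r < r' \<Longrightarrow> R (r', c) < R (r, c)"
  by (auto simp: reverse_valid_def)

lemma reverse_valid_cong: "(\<And>b. b \<in> S \<Longrightarrow> R b = R' b) \<Longrightarrow> reverse_valid S R = reverse_valid S R'"
  unfolding reverse_valid_def by (intro arg_cong2[where f="(\<and>)"]) (metis)+

lemma reverse_valid_subset: "reverse_valid S R \<Longrightarrow> S' \<subseteq> S \<Longrightarrow> reverse_valid S' R"
  unfolding reverse_valid_def by blast

text \<open>\<open>C\<close> stands for the entries of column \<open>a\<close>, the only part of the
  columns to the right that constrains the block; the constant bound \<open>d\<close> means no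
  constraint. Bounding a whole row amounts to bounding its box in column
  \<open>a + 1\<close>.\<close>

definition fillings :: "nat \<Rightarrow> nat \<Rightarrow> (nat \<Rightarrow> nat) \<Rightarrow> (nat \<times> nat \<Rightarrow> nat) set"
  where "fillings a b C = {R \<in> block a b \<rightarrow>\<^sub>E {1..d}. reverse_valid (block a b) R \<and>
    (\<forall>r c. (r, c) \<in> block a b \<longrightarrow> R (r, c) \<le> C r)}"

lemma finite_fillings [simp]: "finite (fillings a b C)"
  unfolding fillings_def
  by (rule finite_subset[OF _ finite_PiE[of "block a b" "\<lambda>_. {1..d}"]]) auto

lemma reverse_tableaux_eq_fillings: "reverse_tableaux d mu = fillings 0 (mu 1) (\<lambda>_. d)"
  unfolding reverse_tableaux_def fillings_def block_all reverse_valid_boxes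
  using PiE_mem by fastforce

text \<open>Every row that reaches the left block has a box in column \<open>b\<close>, so by
  transitivity the two blocks constrain each other only through the entries of that column. Sums
  over tableaux can thus be evaluated column by column.\<close>

lemma sum_fillings_split:
  fixes G H :: "(nat \<times> nat \<Rightarrow> nat) \<Rightarrow> 'a"
  assumes ab: "a < b" and be: "b \<le> e"
  shows "(\<Sum>R\<in>fillings a e C. G (restrict R (block a b)) * H (restrict R (block b e))) =
    (\<Sum>Q\<in>fillings a b C. G Q * (\<Sum>R\<in>fillings b e (\<lambda>r. Q (r, b)). H R))"
proof -
  have Un: "block a e = block a b \<union> block b e" and disj: "block a b \<inter> block b e = {}"
    using ab be by (auto simp: block_def)
  have left: "(r, b) \<in> block a b" if "(r, c) \<in> block b e" for r c
    using that ab box_mono[of r c r b] by (auto simp: block_iff box_iff)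
  have "(\<Sum>R\<in>fillings a e C. G (restrict R (block a b)) * H (restrict R (block b e))) =
     (\<Sum>(Q, R)\<in>Sigma (fillings a b C) (\<lambda>Q. fillings b e (\<lambda>r. Q (r, b))). G Q * H R)"
  proof (rule sum.reindex_bij_witness[where j = "\<lambda>R. (restrict R (block a b), restrict R (block b e))"
         and i = "\<lambda>(Q, R) x. if x \<in> block a b then Q x else R x"], goal_cases)
    case (1 R)
    then have "R \<in> block a e \<rightarrow>\<^sub>E {1..d}" by (simp add: fillings_def)
    then show ?case unfolding Un by (auto simp: fun_eq_iff restrict_def PiE_def extensional_def)
  next
    case (2 R)
    then have R: "R \<in> block a e \<rightarrow>\<^sub>E {1..d}" and v: "reverse_valid (block a e) R"
      and C: "\<And>r c. (r, c) \<in> block a e \<Longrightarrow> R (r, c) \<le> C r"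
      by (auto simp: fillings_def)
    have "restrict R (block a b) \<in> fillings a b C"
      using R C reverse_valid_subset[OF v, of "block a b"] unfolding fillings_def Un
      by (auto simp: cong: reverse_valid_cong)
    moreover have "restrict R (block b e) \<in> fillings b e (\<lambda>r. R (r, b))"
    proof -
      have "R (r, c) \<le> R (r, b)" if "(r, c) \<in> block b e" for r c
        using reverse_valid_row[OF v, of r b c] left[OF that] that by (auto simp: Un block_iff)
      then show ?thesis
        using R reverse_valid_subset[OF v, of "block b e"] unfolding fillings_def Un
        by (auto simp: cong: reverse_valid_cong)
    qed
    moreover have "fillings b e (\<lambda>r. restrict R (block a b) (r, b)) = fillings b e (\<lambda>r. R (r, b))"
      using left unfolding fillings_def by auto
    ultimately show ?case by simp
  next
    case (3 QR)
    obtain Q R where [simp]: "QR = (Q, R)" by (cases QR)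
    from 3 have Q: "Q \<in> block a b \<rightarrow>\<^sub>E {1..d}" and R: "R \<in> block b e \<rightarrow>\<^sub>E {1..d}"
      by (auto simp: fillings_def)
    show ?case using Q R disj by (auto simp: fun_eq_iff restrict_def PiE_def extensional_def)
  next
    case (4 QR)
    obtain Q R where [simp]: "QR = (Q, R)" by (cases QR)
    from 4 have Q: "Q \<in> block a b \<rightarrow>\<^sub>E {1..d}" "reverse_valid (block a b) Q"
        "\<And>r c. (r, c) \<in> block a b \<Longrightarrow> Q (r, c) \<le> C r"
      and R: "R \<in> block b e \<rightarrow>\<^sub>E {1..d}" "reverse_valid (block b e) R"
        "\<And>r c. (r, c) \<in> block b e \<Longrightarrow> R (r, c) \<le> Q (r, b)"
      by (auto simp: fillings_def)
    let ?R = "\<lambda>x. if x \<in> block a b then Q x else R x"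
    have "?R \<in> block a e \<rightarrow>\<^sub>E {1..d}"
      using Q(1) R(1) unfolding Un by (auto simp: PiE_def Pi_def extensional_def)
    moreover have "?R (r, c) \<le> C r" if "(r, c) \<in> block a e" for r c
      using that Q(3)[of r c] Q(3)[of r b] R(3)[of r c] left[of r c] unfolding Un by force
    moreover have "reverse_valid (block a e) ?R"
      unfolding reverse_valid_def
    proof (intro conjI allI impI; elim conjE)
      fix r c c' assume *: "(r, c) \<in> block a e" "(r, c') \<in> block a e" "c < c'"
      show "?R (r, c') \<le> ?R (r, c)"
      proof (cases "c' \<le> b")
        case True
        then show ?thesis using * reverse_valid_row[OF Q(2), of r c c'] by (auto simp: block_iff)
      next
        case False
        then have c': "(r, c') \<in> block b e" "(r, c') \<notin> block a b" using * by (auto simp: block_iff)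
        show ?thesis
        proof (cases "c \<le> b")
          case True
          then have "(r, c) \<in> block a b" using * by (auto simp: block_iff)
          then show ?thesis using c' R(3)[OF c'(1)] reverse_valid_row[OF Q(2), of r c b] left[OF c'(1)] True
            by auto
        next
          case False
          then show ?thesis using * c' reverse_valid_row[OF R(2), of r c c'] by (auto simp: block_iff)
        qed
      qed
    next
      fix r r' c assume *: "(r, c) \<in> block a e" "(r', c) \<in> block a e" "r < r'"
      then show "?R (r', c) < ?R (r, c)"
        using reverse_valid_col[OF Q(2), of r c r'] reverse_valid_col[OF R(2), of r c r']
        by (auto simp: block_iff)
    qed
    ultimately show ?case by (simp add: fillings_def)
  next
    case (5 R)
    then show ?case by simp
  qed
  also have "\<dots> = (\<Sum>Q\<in>fillings a b C. \<Sum>R\<in>fillings b e (\<lambda>r. Q (r, b)). G Q * H R)"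
    by (rule sum.Sigma[symmetric]) auto
  finally show ?thesis by (simp add: sum_distrib_left)
qed

section \<open>Partial sums over the columns still to be read, and their symmetry\<close>

definition factor :: "(nat \<Rightarrow> 'a) \<Rightarrow> (nat \<times> nat \<Rightarrow> nat) \<Rightarrow> nat \<times> nat \<Rightarrow> 'a"
  where "factor x R = (\<lambda>(r, c). x (R (r, c)) - y (compl_index d (R (r, c)) + c - r))"

lemma factor_cong: "R b = R' b \<Longrightarrow> factor x R b = factor x R' b"
  by (cases b) (simp add: factor_def)

definition tail_sum :: "nat \<Rightarrow> (nat \<Rightarrow> nat) \<Rightarrow> (nat \<Rightarrow> 'a) \<Rightarrow> 'a"
  where "tail_sum a C x = (\<Sum>R\<in>fillings a (mu 1) C. \<Prod>b\<in>block a (mu 1). factor x R b)"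

lemma tail_sum_width:
  assumes "mu 1 \<le> a"
  shows "tail_sum a C x = 1"
proof -
  have "block a (mu 1) = {}" using assms by (auto simp: block_def)
  then show ?thesis by (simp add: tail_sum_def fillings_def reverse_valid_def)
qed

lemma tail_sum_Suc:
  assumes "a < mu 1"
  shows "tail_sum a C x = (\<Sum>Q\<in>fillings a (Suc a) C.
    (\<Prod>b\<in>block a (Suc a). factor x Q b) * tail_sum (Suc a) (\<lambda>r. Q (r, Suc a)) x)"
proof -
  have Un: "block a (mu 1) = block a (Suc a) \<union> block (Suc a) (mu 1)"
    and disj: "block a (Suc a) \<inter> block (Suc a) (mu 1) = {}"
    using assms by (auto simp: block_def)
  have "tail_sum a C x = (\<Sum>R\<in>fillings a (mu 1) C.
      (\<Prod>b\<in>block a (Suc a). factor x (restrict R (block a (Suc a))) b) *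
      (\<Prod>b\<in>block (Suc a) (mu 1). factor x (restrict R (block (Suc a) (mu 1))) b))"
    unfolding tail_sum_def Un
    by (subst prod.union_disjoint[OF _ _ disj])
      (auto intro!: sum.cong arg_cong2[where f="(*)"] prod.cong factor_cong)
  also have "\<dots> = (\<Sum>Q\<in>fillings a (Suc a) C.
    (\<Prod>b\<in>block a (Suc a). factor x Q b) * tail_sum (Suc a) (\<lambda>r. Q (r, Suc a)) x)"
    unfolding tail_sum_def using assms by (intro sum_fillings_split) auto
  finally show ?thesis .
qed

lemma swap_invariant_factor:
  "R b \<noteq> k \<Longrightarrow> R b \<noteq> Suc k \<Longrightarrow> swap_invariant k (\<lambda>x. factor x R b)"
  by (cases b) (simp add: factor_def swap_invariant_def)

lemma fillings_col_less:
  "Q \<in> fillings a b C \<Longrightarrow> (r, c) \<in> block a b \<Longrightarrow> (r', c) \<in> block a b \<Longrightarrow> r < r' \<Longrightarrow> Q (r', c) < Q (r, c)"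
  by (auto simp: fillings_def reverse_valid_def)

lemma fillings_le: "Q \<in> fillings a b C \<Longrightarrow> (r, c) \<in> block a b \<Longrightarrow> Q (r, c) \<le> C r"
  by (auto simp: fillings_def)

lemma fillings_col_inj:
  assumes "Q \<in> fillings a b C" "(r, c) \<in> block a b" "(r', c) \<in> block a b" "Q (r, c) = Q (r', c)"
  shows "r = r'"
  using fillings_col_less[OF assms(1), of r c r'] fillings_col_less[OF assms(1), of r' c r] assms
  by (metis less_irrefl linorder_neqE_nat)

lemma block_Suc_cases: "b \<in> block a (Suc a) \<Longrightarrow> \<exists>r. b = (r, Suc a)"
  by (cases b) (auto simp: block_iff)

text \<open>Where the bound is \<open>k\<close>, an entry \<open>k\<close> cannot be raised to
  \<open>k + 1\<close>. This is harmless if the row below is bounded by \<open>k + 1\<close>: column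
  strictness then forces \<open>k + 1\<close> below that \<open>k\<close>, and a column with both
  values need not be changed.\<close>

definition swappable :: "nat \<Rightarrow> nat \<Rightarrow> (nat \<Rightarrow> nat) \<Rightarrow> bool"
  where "swappable k a C \<longleftrightarrow> (\<forall>r. (r, Suc a) \<in> boxes d mu \<and> C r = k \<longrightarrow> 1 < r \<and> C (r - 1) = Suc k)"

text \<open>
  The two fillings that differ by \<open>k\<close> against \<open>k + 1\<close> in a single box are only jointly symmetric;
  the columns to the left that fit \<open>k + 1\<close> but not \<open>k\<close> contribute a factor that completes
  \<open>x k - z'\<close> to a symmetric product.
\<close>

lemma swap_invariant_tail_pair:
  assumes k: "1 \<le> k" "k < d" and r0: "1 \<le> r0" and a: "1 \<le> a"
    and Cr0: "C r0 = Suc k"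
    and above: "\<And>r. (r, Suc a) \<in> boxes d mu \<Longrightarrow> r0 < r \<Longrightarrow> C r < k"
    and below: "\<And>r. (r, Suc a) \<in> boxes d mu \<Longrightarrow> r < r0 \<Longrightarrow> Suc k < C r"
    and inv_a: "\<And>C. swappable k a C \<Longrightarrow> swap_invariant k (tail_sum a C)"
    and inv_Suc: "\<And>C. swappable k (Suc a) C \<Longrightarrow> swap_invariant k (tail_sum (Suc a) C)"
  shows "swap_invariant k (\<lambda>x.
      (x (Suc k) - y (compl_index d (Suc k) + a - r0)) * tail_sum a C x +
      (x k - y (compl_index d k + a - r0)) * tail_sum a (C(r0 := k)) x)"
proof -
  define z z' where "z = y (compl_index d (Suc k) + a - r0)" and "z' = y (compl_index d k + a - r0)"
  have lin: "swap_invariant k (\<lambda>x. x (Suc k) + x k - z - z')"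
    by (simp add: swap_invariant_def)
  have "swappable k a C"
    unfolding swappable_def
  proof (intro allI impI)
    fix r assume "(r, Suc a) \<in> boxes d mu \<and> C r = k"
    then show "1 < r \<and> C (r - 1) = Suc k"
      using above[of r] below[of r] Cr0 by (cases r r0 rule: linorder_cases) auto
  qed
  then have inv: "swap_invariant k (tail_sum a C)" by (rule inv_a)
  show ?thesis
  proof (cases "a < mu 1")
    case False
    then show ?thesis using lin by (simp add: tail_sum_width swap_invariant_def algebra_simps)
  next
    case True
    define X where "X = {Q \<in> fillings a (Suc a) C. (r0, Suc a) \<in> block a (Suc a) \<and> Q (r0, Suc a) = Suc k}"
    define T where "T x Q = (\<Prod>b\<in>block a (Suc a). factor x Q b) * tail_sum (Suc a) (\<lambda>r. Q (r, Suc a)) x" for x Q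
    have sub: "fillings a (Suc a) (C(r0 := k)) = fillings a (Suc a) C - X"
    proof (intro equalityI subsetI)
      fix Q assume Q: "Q \<in> fillings a (Suc a) (C(r0 := k))"
      have "Q (r, c) \<le> C r" if "(r, c) \<in> block a (Suc a)" for r c
        using fillings_le[OF Q that] Cr0 by (cases "r = r0") auto
      then show "Q \<in> fillings a (Suc a) C - X"
        using Q fillings_le[OF Q, of r0 "Suc a"] by (auto simp: fillings_def X_def)
    next
      fix Q assume Q: "Q \<in> fillings a (Suc a) C - X"
      have "Q (r, c) \<le> (C(r0 := k)) r" if b: "(r, c) \<in> block a (Suc a)" for r c
      proof -
        have "c = Suc a" using b by (auto simp: block_iff)
        then show ?thesis using Q b fillings_le[of Q a "Suc a" C r c] Cr0
          by (cases "r = r0") (auto simp: X_def)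
      qed
      then show "Q \<in> fillings a (Suc a) (C(r0 := k))"
        using Q by (auto simp: fillings_def)
    qed
    have XF: "X \<subseteq> fillings a (Suc a) C" by (auto simp: X_def)
    have tail: "tail_sum a (C(r0 := k)) x = tail_sum a C x - (\<Sum>Q\<in>X. T x Q)" for x
      unfolding tail_sum_Suc[OF True] sub T_def[symmetric] by (simp add: sum_diff XF)
    have Xinv: "swap_invariant k (\<lambda>x. (x k - z') * T x Q)" if Q: "Q \<in> X" for Q
    proof -
      let ?B = "block a (Suc a)" and ?b = "(r0, Suc a)"
      have b: "?b \<in> ?B" and Qb: "Q ?b = Suc k" and QF: "Q \<in> fillings a (Suc a) C"
        using Q by (auto simp: X_def)
      have ne: "Q (r, Suc a) \<noteq> k \<and> Q (r, Suc a) \<noteq> Suc k" if "(r, Suc a) \<in> ?B" "r \<noteq> r0" for r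
        using that fillings_col_less[OF QF, of r "Suc a" r0] fillings_le[OF QF, of r "Suc a"] b Qb
          above[of r] by (cases r r0 rule: linorder_cases) (auto simp: block_iff)
      have "swappable k (Suc a) (\<lambda>r. Q (r, Suc a))"
        unfolding swappable_def
      proof (intro allI impI)
        fix r assume *: "(r, Suc (Suc a)) \<in> boxes d mu \<and> Q (r, Suc a) = k"
        then have "(r, Suc a) \<in> ?B" using box_mono[of r "Suc (Suc a)" r "Suc a"] by (auto simp: block_iff box_iff)
        then show "1 < r \<and> Q (r - 1, Suc a) = Suc k" using ne[of r] * Qb by (cases "r = r0") auto
      qed
      then have t: "swap_invariant k (tail_sum (Suc a) (\<lambda>r. Q (r, Suc a)))" by (rule inv_Suc)
      have o: "swap_invariant k (\<lambda>x. \<Prod>b\<in>?B - {?b}. factor x Q b)"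
      proof (intro swap_invariant_prod swap_invariant_factor)
        fix b assume b: "b \<in> ?B - {?b}"
        then obtain r where "b = (r, Suc a)" using block_Suc_cases by blast
        then show "Q b \<noteq> k" "Q b \<noteq> Suc k" using b ne[of r] by auto
      qed
      \<comment> \<open>A \<open>k + 1\<close> one column to the left of a \<open>k\<close> has the
        same index of \<open>y\<close>; this is why \<open>z'\<close> reappears.\<close>
      have f: "factor x Q ?b = x (Suc k) - z'" for x
        using k by (simp add: factor_def Qb z'_def compl_index_def Suc_diff_le)
      have "swap_invariant k (\<lambda>x. (x k - z') * (x (Suc k) - z'))"
        by (simp add: swap_invariant_def)
      from swap_invariant_mult[OF this swap_invariant_mult[OF o t]]
      show ?thesis
        by (rule swap_invariant_cong[rotated]) (simp add: T_def prod.remove[OF _ b] f mult_ac)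
    qed
    \<comment> \<open>The pair is \<open>(x (Suc k) + x k - z - z') * tail_sum a C x\<close> minus
      the sum over \<open>X\<close> of \<open>(x k - z') * T x Q\<close>, and both parts are
      symmetric.\<close>
    from swap_invariant_diff[OF swap_invariant_mult[OF lin inv] swap_invariant_sum[of X, OF Xinv]]
    show ?thesis
    proof (rule swap_invariant_cong[rotated])
      fix x
      have "(\<Sum>Q\<in>X. (x k - z') * T x Q) = (x k - z') * (\<Sum>Q\<in>X. T x Q)"
        by (rule sum_distrib_left[symmetric])
      then show "(x (Suc k) - y (compl_index d (Suc k) + a - r0)) * tail_sum a C x +
          (x k - y (compl_index d k + a - r0)) * tail_sum a (C(r0 := k)) x =
          (x (Suc k) + x k - z - z') * tail_sum a C x - (\<Sum>Q\<in>X. (x k - z') * T x Q)"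
        unfolding tail z_def[symmetric] z'_def[symmetric] by (simp only:) (simp add: algebra_simps)
    qed
  qed
qed

text \<open>A first column with both or neither of \<open>k\<close> and \<open>k + 1\<close> gives a
  symmetric term by itself. A column with exactly one of them is paired with the column that has the
  other in its place, and \<open>swap_invariant_tail_pair\<close> handles the two terms together.
  That lemma looks one column further, so invariance is assumed for two successive columns.\<close>

lemma swap_invariant_tail_step:
  assumes k: "1 \<le> k" "k < d" and a: "a < mu 1" and C: "swappable k a C"
    and inv1: "\<And>C. swappable k (Suc a) C \<Longrightarrow> swap_invariant k (tail_sum (Suc a) C)"
    and inv2: "\<And>C. swappable k (Suc (Suc a)) C \<Longrightarrow> swap_invariant k (tail_sum (Suc (Suc a)) C)"
  shows "swap_invariant k (tail_sum a C)"
proof -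
  let ?B = "block a (Suc a)" and ?F = "fillings a (Suc a) C"
  define T where "T x Q = (\<Prod>b\<in>?B. factor x Q b) * tail_sum (Suc a) (\<lambda>r. Q (r, Suc a)) x" for x Q
  define has where "has v Q \<longleftrightarrow> (\<exists>b\<in>?B. Q b = v)" for v :: nat and Q
  define N where "N = {Q \<in> ?F. has k Q \<longleftrightarrow> has (Suc k) Q}"
  define L where "L = {Q \<in> ?F. has k Q \<and> \<not> has (Suc k) Q}"
  define H where "H = {Q \<in> ?F. has (Suc k) Q \<and> \<not> has k Q}"
  define down where "down Q = (\<lambda>b. if b \<in> ?B \<and> Q b = Suc k then k else Q b)" for Q :: "nat \<times> nat \<Rightarrow> nat"
  define up where "up Q = (\<lambda>b. if b \<in> ?B \<and> Q b = k then Suc k else Q b)" for Q :: "nat \<times> nat \<Rightarrow> nat"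
  have nextB: "(r, Suc a) \<in> ?B" if "(r, Suc (Suc a)) \<in> boxes d mu" for r
    using box_mono[OF that, of r "Suc a"] that by (auto simp: block_iff box_iff)
  \<comment> \<open>Here \<open>swappable\<close> enters: a bound \<open>k\<close> would force
    \<open>k + 1\<close> into the row below, but columns in \<open>L\<close> contain none.\<close>
  have up_le: "Suc k \<le> C r" if Q: "Q \<in> L" and r: "(r, Suc a) \<in> ?B" "Q (r, Suc a) = k" for Q r
  proof (rule ccontr)
    assume not: "\<not> Suc k \<le> C r"
    have QF: "Q \<in> ?F" using Q by (simp add: L_def)
    then have "C r = k" using fillings_le[OF QF r(1)] r not by simp
    with C r have r1: "1 < r" "C (r - 1) = Suc k" by (auto simp: swappable_def block_iff)
    have b: "(r - 1, Suc a) \<in> ?B" using r1 r box_mono[of r "Suc a" "r - 1" "Suc a"] by (auto simp: block_iff)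
    have "Q (r - 1, Suc a) = Suc k"
      using fillings_le[OF QF b] fillings_col_less[OF QF b r(1)] r r1 by simp
    then show False using Q b by (auto simp: L_def has_def)
  qed
  have down_L: "down Q \<in> L" if "Q \<in> H" for Q
  proof -
    have F: "Q \<in> ?F" and no: "\<And>b. b \<in> ?B \<Longrightarrow> Q b \<noteq> k" and ex: "\<exists>b\<in>?B. Q b = Suc k"
      using that by (auto simp: H_def has_def)
    have lt: "(r, c) \<in> ?B \<Longrightarrow> (r', c) \<in> ?B \<Longrightarrow> r < r' \<Longrightarrow> down Q (r', c) < down Q (r, c)" for r r' c
      using fillings_col_less[OF F, of r c r'] no[of "(r', c)"] by (auto simp: down_def)
    have le: "(r, c) \<in> ?B \<Longrightarrow> down Q (r, c) \<le> C r" for r c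
      using fillings_le[OF F, of r c] by (auto simp: down_def)
    have "down Q \<in> ?B \<rightarrow>\<^sub>E {1..d}"
      using F k by (auto simp: fillings_def PiE_def Pi_def extensional_def down_def)
    then have "down Q \<in> ?F"
      using lt le unfolding fillings_def reverse_valid_def by (auto simp: block_iff)
    then show ?thesis using no ex by (auto simp: L_def has_def down_def)
  qed
  have up_H: "up Q \<in> H" if "Q \<in> L" for Q
  proof -
    have F: "Q \<in> ?F" and no: "\<And>b. b \<in> ?B \<Longrightarrow> Q b \<noteq> Suc k" and ex: "\<exists>b\<in>?B. Q b = k"
      using that by (auto simp: L_def has_def)
    have lt: "(r, c) \<in> ?B \<Longrightarrow> (r', c) \<in> ?B \<Longrightarrow> r < r' \<Longrightarrow> up Q (r', c) < up Q (r, c)" for r r' c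
      using fillings_col_less[OF F, of r c r'] no[of "(r, c)"] by (auto simp: up_def)
    have le: "(r, c) \<in> ?B \<Longrightarrow> up Q (r, c) \<le> C r" for r c
      using fillings_le[OF F, of r c] up_le[OF that, of r] by (auto simp: up_def block_iff le_Suc_eq)
    have "up Q \<in> ?B \<rightarrow>\<^sub>E {1..d}" using F k by (auto simp: fillings_def PiE_def Pi_def extensional_def up_def)
    then have "up Q \<in> ?F"
      using lt le unfolding fillings_def reverse_valid_def by (auto simp: block_iff)
    then show ?thesis using no ex by (auto simp: H_def has_def up_def)
  qed
  have LH: "(\<Sum>Q\<in>L. T x Q) = (\<Sum>Q\<in>H. T x (down Q))" for x
  proof (rule sum.reindex_bij_witness[where i = down and j = up])
    show "down (up Q) = Q" if "Q \<in> L" for Q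
      using that by (auto simp: fun_eq_iff down_def up_def L_def has_def)
    show "up (down Q) = Q" if "Q \<in> H" for Q
      using that by (auto simp: fun_eq_iff down_def up_def H_def has_def)
    show "T x (down (up Q)) = T x Q" if "Q \<in> L" for Q
      using \<open>Q \<in> L \<Longrightarrow> down (up Q) = Q\<close> that by simp
  qed (use down_L up_H in auto)
  have "?F = N \<union> (L \<union> H)" by (auto simp: N_def L_def H_def)
  then have "(\<Sum>Q\<in>?F. T x Q) = (\<Sum>Q\<in>N. T x Q) + ((\<Sum>Q\<in>L. T x Q) + (\<Sum>Q\<in>H. T x Q))" for x
  proof -
    have "finite N" "finite L" "finite H" by (simp_all add: N_def L_def H_def)
    moreover have "N \<inter> (L \<union> H) = {}" "L \<inter> H = {}" by (auto simp: N_def L_def H_def)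
    ultimately show ?thesis using \<open>?F = N \<union> (L \<union> H)\<close> by (simp add: sum.union_disjoint)
  qed
  then have expand: "tail_sum a C x = (\<Sum>Q\<in>N. T x Q) + (\<Sum>Q\<in>H. T x Q + T x (down Q))" for x
    unfolding tail_sum_Suc[OF a] T_def[symmetric] by (simp add: LH sum.distrib)
  have N: "swap_invariant k (\<lambda>x. T x Q)" if Q: "Q \<in> N" for Q
  proof (cases "has k Q")
    case False
    then have no: "b \<in> ?B \<Longrightarrow> Q b \<noteq> k \<and> Q b \<noteq> Suc k" for b using Q by (auto simp: N_def has_def)
    then have "swappable k (Suc a) (\<lambda>r. Q (r, Suc a))" using nextB by (auto simp: swappable_def)
    from inv1[OF this] have "swap_invariant k (\<lambda>x. (\<Prod>b\<in>?B. factor x Q b) * tail_sum (Suc a) (\<lambda>r. Q (r, Suc a)) x)"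
      using no by (intro swap_invariant_mult[OF swap_invariant_prod] swap_invariant_factor) auto
    then show ?thesis unfolding T_def .
  next
    case True
    then have F: "Q \<in> ?F" and "has (Suc k) Q" using Q by (auto simp: N_def)
    with True obtain rL rH where rL: "(rL, Suc a) \<in> ?B" "Q (rL, Suc a) = k"
      and rH: "(rH, Suc a) \<in> ?B" "Q (rH, Suc a) = Suc k"
      unfolding has_def using block_Suc_cases by blast
    have "rH < rL" using fillings_col_less[OF F rL(1) rH(1)] rL rH
      by (cases rH rL rule: linorder_cases) auto
    have eq: "rL = Suc rH"
    proof (rule ccontr)
      assume "rL \<noteq> Suc rH"
      then have lt: "Suc rH < rL" using \<open>rH < rL\<close> by simp
      then have b: "(Suc rH, Suc a) \<in> ?B" using rL box_mono[of rL "Suc a" "Suc rH" "Suc a"] by (auto simp: block_iff)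
      show False using fillings_col_less[OF F b rL(1) lt] fillings_col_less[OF F rH(1) b] rL rH by simp
    qed
    have sw: "swappable k (Suc a) (\<lambda>r. Q (r, Suc a))"
      unfolding swappable_def
    proof (intro allI impI)
      fix r assume *: "(r, Suc (Suc a)) \<in> boxes d mu \<and> Q (r, Suc a) = k"
      then have "r = rL" using fillings_col_inj[OF F _ rL(1)] nextB[of r] rL by auto
      then show "1 < r \<and> Q (r - 1, Suc a) = Suc k" using eq rH by (auto simp: block_iff box_iff)
    qed
    let ?B' = "?B - {(rL, Suc a)} - {(rH, Suc a)}"
    have o: "swap_invariant k (\<lambda>x. \<Prod>b\<in>?B'. factor x Q b)"
    proof (intro swap_invariant_prod swap_invariant_factor)
      fix b assume b: "b \<in> ?B'"
      then obtain r where "b = (r, Suc a)" using block_Suc_cases by blast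
      then show "Q b \<noteq> k" "Q b \<noteq> Suc k"
        using b fillings_col_inj[OF F _ rL(1), of r] fillings_col_inj[OF F _ rH(1), of r] rL rH by auto
    qed
    \<comment> \<open>The higher row of the \<open>k\<close> compensates for its entry being smaller
      by one, so both factors subtract the same \<open>y\<close>.\<close>
    define z where "z = y (compl_index d k + a - rH)"
    have f: "factor x Q (rL, Suc a) = x k - z" "factor x Q (rH, Suc a) = x (Suc k) - z" for x
    proof -
      have "compl_index d k + Suc a - rL = compl_index d k + a - rH"
        "compl_index d (Suc k) + Suc a - rH = compl_index d k + a - rH"
        using k eq by (auto simp: compl_index_def)
      then show "factor x Q (rL, Suc a) = x k - z" "factor x Q (rH, Suc a) = x (Suc k) - z"
        by (simp_all add: factor_def rL(2) rH(2) z_def)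
    qed
    have "swap_invariant k (\<lambda>x. (x k - z) * (x (Suc k) - z))" by (simp add: swap_invariant_def)
    from swap_invariant_mult[OF this swap_invariant_mult[OF o inv1[OF sw]]]
    show ?thesis
    proof (rule swap_invariant_cong[rotated])
      fix x
      have "(\<Prod>b\<in>?B. factor x Q b) = (x k - z) * ((x (Suc k) - z) * (\<Prod>b\<in>?B'. factor x Q b))"
      proof -
        have "(\<Prod>b\<in>?B. factor x Q b) = factor x Q (rL, Suc a) * (\<Prod>b\<in>?B - {(rL, Suc a)}. factor x Q b)"
          using rL(1) by (intro prod.remove) auto
        also have "(\<Prod>b\<in>?B - {(rL, Suc a)}. factor x Q b) = factor x Q (rH, Suc a) * (\<Prod>b\<in>?B'. factor x Q b)"
          using rH(1) eq by (intro prod.remove) auto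
        finally show ?thesis by (simp only: f)
      qed
      then show "T x Q = (x k - z) * (x (Suc k) - z) *
          ((\<Prod>b\<in>?B'. factor x Q b) * tail_sum (Suc a) (\<lambda>r. Q (r, Suc a)) x)"
        by (simp add: T_def mult_ac)
    qed
  qed
  have H: "swap_invariant k (\<lambda>x. T x Q + T x (down Q))" if Q: "Q \<in> H" for Q
  proof -
    have F: "Q \<in> ?F" and no: "\<And>b. b \<in> ?B \<Longrightarrow> Q b \<noteq> k" and "\<exists>b\<in>?B. Q b = Suc k"
      using Q by (auto simp: H_def has_def)
    then obtain r0 where r0: "(r0, Suc a) \<in> ?B" "Q (r0, Suc a) = Suc k" using block_Suc_cases by blast
    let ?B' = "?B - {(r0, Suc a)}" and ?C = "\<lambda>r. Q (r, Suc a)"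
    have other: "Q b \<noteq> Suc k" if "b \<in> ?B'" for b
    proof -
      from that obtain r where "b = (r, Suc a)" using block_Suc_cases by blast
      then show ?thesis using that r0 fillings_col_inj[OF F _ r0(1), of r] by auto
    qed
    have col: "(\<lambda>r. down Q (r, Suc a)) = ?C(r0 := k)"
      using r0 other by (auto simp: down_def fun_eq_iff)
    have o: "swap_invariant k (\<lambda>x. \<Prod>b\<in>?B'. factor x Q b)"
      using other no by (intro swap_invariant_prod swap_invariant_factor) auto
    have od: "(\<Prod>b\<in>?B'. factor x (down Q) b) = (\<Prod>b\<in>?B'. factor x Q b)" for x
      using other by (intro prod.cong factor_cong) (auto simp: down_def)
    have fQ: "factor x Q (r0, Suc a) = x (Suc k) - y (compl_index d (Suc k) + Suc a - r0)" for x
      by (simp add: factor_def r0)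
    have fd: "factor x (down Q) (r0, Suc a) = x k - y (compl_index d k + Suc a - r0)" for x
      using r0 by (simp add: factor_def down_def)
    have pair: "swap_invariant k (\<lambda>x.
        (x (Suc k) - y (compl_index d (Suc k) + Suc a - r0)) * tail_sum (Suc a) ?C x +
        (x k - y (compl_index d k + Suc a - r0)) * tail_sum (Suc a) (?C(r0 := k)) x)"
    proof (rule swap_invariant_tail_pair[OF k])
      show "1 \<le> r0" using r0 by (auto simp: block_iff box_iff)
      show "?C r < k" if "(r, Suc (Suc a)) \<in> boxes d mu" "r0 < r" for r
        using fillings_col_less[OF F r0(1) nextB[OF that(1)] that(2)] no[OF nextB[OF that(1)]] r0 by simp
      show "Suc k < ?C r" if "(r, Suc (Suc a)) \<in> boxes d mu" "r < r0" for r
        using fillings_col_less[OF F nextB[OF that(1)] r0(1) that(2)] r0 by simp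
    qed (use r0 inv1 inv2 in auto)
    from swap_invariant_mult[OF o pair] show ?thesis
      by (rule swap_invariant_cong[rotated])
        (simp add: T_def prod.remove[OF _ r0(1)] od fQ fd col algebra_simps)
  qed
  have "swap_invariant k (\<lambda>x. \<Sum>Q\<in>N. T x Q)" "swap_invariant k (\<lambda>x. \<Sum>Q\<in>H. T x Q + T x (down Q))"
    using N H by (simp_all add: swap_invariant_sum)
  from swap_invariant_add[OF this] show ?thesis by (rule swap_invariant_cong[rotated]) (rule expand)
qed

lemma swap_invariant_tail_sum:
  assumes k: "1 \<le> k" "k < d" and "swappable k a C"
  shows "swap_invariant k (tail_sum a C)"
  using assms(3)
proof (induction "mu 1 - a" arbitrary: a C rule: less_induct)
  case less
  show ?case
  proof (cases "a < mu 1")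
    case True
    show ?thesis
    proof (rule swap_invariant_tail_step[OF k True less.prems])
      show "swap_invariant k (tail_sum (Suc a) C)" if "swappable k (Suc a) C" for C
        using that True by (intro less.hyps) simp_all
      show "swap_invariant k (tail_sum (Suc (Suc a)) C)" if "swappable k (Suc (Suc a)) C" for C
        using that True by (intro less.hyps) simp_all
    qed
  next
    case False
    then show ?thesis by (simp add: tail_sum_width swap_invariant_def)
  qed
qed

end

subsection \<open>Expansion of an alternant times a factorial Schur function\<close>

lemma content_Nil [simp]: "content [] k = 0"
  by (simp add: content_def)

lemma content_append [simp]: "content (u @ v) k = content u k + content v k"
  by (simp add: content_def)

lemma content_single [simp]: "content [v] k = (if v = k then 1 else 0)"
  by (simp add: content_def)

lemma content_map:
  assumes "distinct bs"
  shows "content (map T bs) k = card {b \<in> set bs. T b = k}"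
  using assms
proof (induction bs)
  case (Cons b bs)
  have "{b' \<in> set (b # bs). T b' = k} = (if T b = k then {b} else {}) \<union> {b' \<in> set bs. T b' = k}"
    by auto
  then show ?case using Cons by (auto simp: content_def card_insert_if)
qed (simp add: content_def)

lemma unbarred_entries_append:
  "unbarred_entries U (bs @ cs) = unbarred_entries U bs @ unbarred_entries U cs"
  by (simp add: unbarred_entries_def)

lemma unbarred_entries_single:
  "unbarred_entries U [b] = (if is_barred (U b) then [] else [entry_val (U b)])"
  by (simp add: unbarred_entries_def)

lemma unbarred_entries_Nil [simp]: "unbarred_entries U [] = []"
  by (simp add: unbarred_entries_def)

lemma unbarred_entries_cong:
  "(\<And>b. b \<in> set bs \<Longrightarrow> U b = U' b) \<Longrightarrow> unbarred_entries U bs = unbarred_entries U' bs"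
  unfolding unbarred_entries_def by (induction bs) auto

lemma content_unbarred_entries:
  assumes "distinct bs"
  shows "content (unbarred_entries U bs) k = card {b \<in> set bs. U b = Unbarred k}"
  using assms
proof (induction bs)
  case (Cons b bs)
  have "{b' \<in> set (b # bs). U b' = Unbarred k} =
      (if U b = Unbarred k then {b} else {}) \<union> {b' \<in> set bs. U b' = Unbarred k}"
    by auto
  then show ?case using Cons
    by (cases "U b") (auto simp: content_def unbarred_entries_def card_insert_if)
qed simp

lemma yamanouchi_Nil [simp]: "yamanouchi d []"
  by (simp add: yamanouchi_def)

lemma yamanouchi_snoc:
  "yamanouchi d (w @ [v]) \<longleftrightarrow> yamanouchi d w \<and>
    (\<forall>k. 1 \<le> k \<and> k < d \<longrightarrow> content (w @ [v]) (k + 1) \<le> content (w @ [v]) k)"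
  unfolding yamanouchi_def by (auto simp: le_Suc_eq all_conj_distrib)

lemma yamanouchi_appendD: "yamanouchi d (u @ v) \<Longrightarrow> yamanouchi d u"
proof (induction v rule: rev_induct)
  case (snoc a v)
  then show ?case using yamanouchi_snoc[of d "u @ v" a] by simp
qed simp

lemma yamanouchi_content_Suc:
  "yamanouchi d w \<Longrightarrow> 1 \<le> k \<Longrightarrow> k < d \<Longrightarrow> content w (Suc k) \<le> content w k"
  unfolding yamanouchi_def by (drule spec[of _ "length w"]) simp

lemma yamanouchi_content_mono:
  assumes "yamanouchi d w" "1 \<le> i" "i \<le> j" "j \<le> d"
  shows "content w j \<le> content w i"
  using assms(3,4)
proof (induction j rule: dec_induct)
  case (step n)
  then show ?case using yamanouchi_content_Suc[OF assms(1), of n] assms(2) by simp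
qed simp

lemma takeWhile_neq_nth:
  assumes "distinct bs" "n < length bs"
  shows "takeWhile (\<lambda>b. b \<noteq> bs ! n) bs = take n bs"
  using assms by (intro takeWhile_eq_take_P_nth) (auto simp: nth_eq_iff_index_eq)

lemma nth_notin_take: "distinct xs \<Longrightarrow> n < length xs \<Longrightarrow> xs ! n \<notin> set (take n xs)"
  by (auto simp: in_set_conv_nth nth_eq_iff_index_eq)

lemma sorted_wrt_concat_map:
  assumes "sorted_wrt P xs" "\<And>x. x \<in> set xs \<Longrightarrow> sorted_wrt Q (f x)"
    and "\<And>x x' a b. P x x' \<Longrightarrow> a \<in> set (f x) \<Longrightarrow> b \<in> set (f x') \<Longrightarrow> Q a b"
  shows "sorted_wrt Q (concat (map f xs))"
  using assms(1,2) by (induction xs) (auto simp: sorted_wrt_append intro: assms(3))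

lemma distinct_sorted_wrt:
  assumes "sorted_wrt P xs" "\<And>x. \<not> P x x"
  shows "distinct xs"
  using assms by (induction xs) auto

text \<open>Describes a prefix of a reading by position in the diagram; used to count letters and to
  recognise the set of boxes already read.\<close>

lemma set_take_sorted_wrt:
  assumes s: "sorted_wrt P xs" and asym: "\<And>x y. P x y \<Longrightarrow> \<not> P y x" and n: "n < length xs"
  shows "set (take n xs) = {x \<in> set xs. P x (xs ! n)}"
proof (intro equalityI subsetI)
  fix x assume "x \<in> set (take n xs)"
  then obtain i where "i < n" "x = xs ! i" by (auto simp: in_set_conv_nth)
  then show "x \<in> {x \<in> set xs. P x (xs ! n)}" using s n by (auto simp: sorted_wrt_iff_nth_less)
next
  fix x assume "x \<in> {x \<in> set xs. P x (xs ! n)}"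
  then obtain i where i: "i < length xs" "x = xs ! i" "P (xs ! i) (xs ! n)" by (auto simp: in_set_conv_nth)
  have "\<not> n < i" using s i asym by (auto simp: sorted_wrt_iff_nth_less)
  moreover have "n \<noteq> i" using i asym by auto
  ultimately have "i < n" by simp
  then show "x \<in> set (take n xs)" using i n by (auto simp: in_set_conv_nth)
qed

text \<open>Row numbers grow upwards, so reading a column from top to bottom means decreasing row
  number.\<close>

definition before_reverse :: "nat \<times> nat \<Rightarrow> nat \<times> nat \<Rightarrow> bool"
  where "before_reverse = (\<lambda>(r, c) (r', c'). c < c' \<or> c = c' \<and> r' < r)"

lemma before_reverse_asym: "before_reverse b b' \<Longrightarrow> \<not> before_reverse b' b"
  by (auto simp: before_reverse_def)

lemma sorted_wrt_reverse_reading: "sorted_wrt before_reverse (reverse_reading d mu)"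
proof -
  have col: "sorted_wrt before_reverse (concat (map (\<lambda>r. if c \<le> mu r then [(r, c)] else []) (rev [1..<d + 1])))" for c
    by (rule sorted_wrt_concat_map[where P = "\<lambda>r r'. r' < r"])
      (auto simp: sorted_wrt_rev before_reverse_def simp del: upt_Suc split: if_splits)
  show ?thesis
    unfolding reverse_reading_def
    by (rule sorted_wrt_concat_map[where P = "(<)"], simp del: upt_Suc, rule col)
      (auto simp: before_reverse_def split: if_splits)
qed

lemma distinct_reverse_reading: "distinct (reverse_reading d mu)"
  using sorted_wrt_reverse_reading by (rule distinct_sorted_wrt) (auto simp: before_reverse_def)

section \<open>Antisymmetrization over the symmetric group\<close>

definition antisymmetrize :: "nat \<Rightarrow> ((nat \<Rightarrow> 'a) \<Rightarrow> 'a) \<Rightarrow> (nat \<Rightarrow> 'a) \<Rightarrow> 'a::{idom,ring_char_0}"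
  where "antisymmetrize d f x = (\<Sum>p | p permutes {1..d}. of_int (sign p) * f (x \<circ> p))"

text \<open>Composing every permutation with the transposition reverses all signs and keeps all
  values, so the sum is its own negative.\<close>

lemma antisymmetrize_swap_invariant:
  assumes f: "swap_invariant k f" and k: "1 \<le> k" "k < d"
  shows "antisymmetrize d f x = 0"
proof -
  let ?t = "transpose k (Suc k)" and ?P = "{p. p permutes {1..d}}"
  have t: "?t permutes {1..d}" using k by (intro permutes_swap_id) auto
  have "antisymmetrize d f x = (\<Sum>p\<in>?P. of_int (sign (p \<circ> ?t)) * f (x \<circ> (p \<circ> ?t)))"
    unfolding antisymmetrize_def by (rule sum_permutations_compose_right[OF t])
  also have "\<dots> = (\<Sum>p\<in>?P. - (of_int (sign p) * f (x \<circ> p)))"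
  proof (rule sum.cong[OF refl])
    fix p assume "p \<in> ?P"
    then have "sign (p \<circ> ?t) = - sign p"
      using t by (subst sign_compose) (auto intro: permutes_imp_permutation[of "{1..d}"] simp: sign_swap_id)
    moreover have "f (x \<circ> (p \<circ> ?t)) = f (x \<circ> p)"
      using swap_invariantD[OF f, of "x \<circ> p"] by (simp add: comp_assoc)
    ultimately show "of_int (sign (p \<circ> ?t)) * f (x \<circ> (p \<circ> ?t)) = - (of_int (sign p) * f (x \<circ> p))"
      by simp
  qed
  also have "\<dots> = - antisymmetrize d f x"
    by (simp add: antisymmetrize_def sum_negf)
  finally have "2 * antisymmetrize d f x = 0" by simp
  then show ?thesis by simp
qed

text \<open>The transposition of \<open>a\<close> and \<open>Suc c\<close> is the adjacent one of
  \<open>c\<close> and \<open>Suc c\<close> conjugated by that of \<open>a\<close> and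
  \<open>c\<close>; hence adjacent transpositions suffice.\<close>

lemma permutation_invariant:
  assumes inv: "\<And>k. 1 \<le> k \<Longrightarrow> k < d \<Longrightarrow> swap_invariant k f" and p: "p permutes {1..d}"
  shows "f (x \<circ> p) = f x"
proof -
  have less: "f (x \<circ> transpose a b) = f x" if "a < b" "1 \<le> a" "b \<le> d" for a b x
    using that
  proof (induction "b - a" arbitrary: a b x rule: less_induct)
    case less
    show ?case
    proof (cases "b = Suc a")
      case True
      then show ?thesis using less.prems swap_invariantD[OF inv[of a]] by simp
    next
      case False
      then obtain c where c: "b = Suc c" "a < c" using less.prems by (cases b) auto
      have IH: "f (z \<circ> transpose a c) = f z" for z
        using c less.prems by (intro less.hyps) auto
      have "transpose a c \<circ> transpose c b \<circ> transpose a c = transpose a b"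
        using c by (intro transpose_comp_triple) auto
      then have "f (x \<circ> transpose a b) = f (((x \<circ> transpose a c) \<circ> transpose c (Suc c)) \<circ> transpose a c)"
        by (simp add: comp_assoc c)
      also have "\<dots> = f ((x \<circ> transpose a c) \<circ> transpose c (Suc c))" by (rule IH)
      also have "\<dots> = f (x \<circ> transpose a c)"
        using c less.prems by (intro swap_invariantD inv) auto
      also have "\<dots> = f x" by (rule IH)
      finally show ?thesis .
    qed
  qed
  have transp: "f (x \<circ> transpose a b) = f x" if "a \<noteq> b" "a \<in> {1..d}" "b \<in> {1..d}" for a b x
    using that less[of a b x] less[of b a x] by (cases "a < b") (auto simp: transpose_commute)
  show ?thesis
    using p finite_atLeastAtMost
  proof (induction arbitrary: x rule: permutes_induct)
    case (swap a b p)
    have "f (x \<circ> (transpose a b \<circ> p)) = f ((x \<circ> transpose a b) \<circ> p)" by (simp add: comp_assoc)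
    also have "\<dots> = f (x \<circ> transpose a b)" by (rule swap.IH)
    also have "\<dots> = f x" using swap.hyps by (intro transp)
    finally show ?case .
  qed simp
qed

lemma antisymmetrize_sum:
  "antisymmetrize d (\<lambda>x. \<Sum>i\<in>S. f i x) x = (\<Sum>i\<in>S. antisymmetrize d (f i) x)"
  unfolding antisymmetrize_def sum_distrib_left by (rule sum.swap)

lemma antisymmetrize_add:
  "antisymmetrize d (\<lambda>x. f x + g x) x = antisymmetrize d f x + antisymmetrize d g x"
  by (simp add: antisymmetrize_def sum.distrib algebra_simps)

lemma antisymmetrize_scale:
  "antisymmetrize d (\<lambda>x. c * f x) x = c * antisymmetrize d f x"
  by (simp add: antisymmetrize_def sum_distrib_left mult_ac)

lemma sum_PiE_insert:
  assumes "b \<notin> B"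
  shows "(\<Sum>U\<in>insert b B \<rightarrow>\<^sub>E E. F U) = (\<Sum>U\<in>B \<rightarrow>\<^sub>E E. \<Sum>e\<in>E. F (U(b := e)))"
proof -
  have "(\<Sum>U\<in>insert b B \<rightarrow>\<^sub>E E. F U) = (\<Sum>(e, U)\<in>E \<times> (B \<rightarrow>\<^sub>E E). F (U(b := e)))"
    unfolding PiE_insert_eq using inj_combinator[OF assms, of "\<lambda>_. E"]
    by (subst sum.reindex) (auto simp: case_prod_unfold)
  also have "\<dots> = (\<Sum>e\<in>E. \<Sum>U\<in>B \<rightarrow>\<^sub>E E. F (U(b := e)))"
    by (rule sum.cartesian_product[symmetric])
  finally show ?thesis by (subst sum.swap)
qed

section \<open>Reading the boxes one at a time\<close>

context shape
begin

definition falling :: "'a \<Rightarrow> nat \<Rightarrow> 'a"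
  where "falling z n = (\<Prod>i=1..n. z - y i)"

definition monom :: "(nat \<Rightarrow> nat) \<Rightarrow> (nat \<Rightarrow> 'a) \<Rightarrow> 'a"
  where "monom \<beta> x = (\<Prod>i=1..d. falling (x i) (\<beta> i))"

lemma swap_invariant_monom:
  assumes "\<beta> k = \<beta> (Suc k)" "1 \<le> k" "k < d"
  shows "swap_invariant k (monom \<beta>)"
  unfolding swap_invariant_def
proof
  fix x :: "nat \<Rightarrow> 'a"
  let ?t = "transpose k (Suc k)"
  have t: "?t permutes {1..d}" using assms by (intro permutes_swap_id) auto
  have "\<beta> (?t i) = \<beta> i" for i using assms by (auto simp: transpose_def)
  then show "monom \<beta> (x \<circ> ?t) = monom \<beta> x"
    unfolding monom_def by (subst (2) prod.permute[OF t]) (simp add: o_def)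
qed

text \<open>Insert \<open>y (Suc (\<beta> v))\<close> between \<open>x v\<close> and
  \<open>z\<close>: the first difference is the next factor of the falling product, the second is a
  scalar.\<close>

lemma monom_mult:
  assumes "v \<in> {1..d}"
  shows "monom \<beta> x * (x v - z) = monom (\<beta>(v := Suc (\<beta> v))) x + (y (Suc (\<beta> v)) - z) * monom \<beta> x"
proof -
  let ?M = "\<Prod>i\<in>{1..d} - {v}. falling (x i) (\<beta> i)"
  have 1: "monom \<beta> x = falling (x v) (\<beta> v) * ?M"
    unfolding monom_def using assms by (intro prod.remove) auto
  have "monom (\<beta>(v := Suc (\<beta> v))) x = falling (x v) (Suc (\<beta> v)) * (\<Prod>i\<in>{1..d} - {v}. falling (x i) ((\<beta>(v := Suc (\<beta> v))) i))"
    unfolding monom_def using assms by (subst prod.remove[of _ v]) auto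
  also have "\<dots> = falling (x v) (\<beta> v) * (x v - y (Suc (\<beta> v))) * ?M"
    by (simp add: falling_def)
  finally show ?thesis unfolding 1 by (simp add: algebra_simps)
qed

text \<open>The staircase shift turns weakly decreasing contents into strictly decreasing exponents,
  as an alternant needs to be nonzero.\<close>

definition exponent :: "nat list \<Rightarrow> nat \<Rightarrow> nat"
  where "exponent w i = d - i + content w i"

lemma exponent_snoc: "exponent (w @ [v]) = (exponent w)(v := Suc (exponent w v))"
  by (auto simp: exponent_def)

text \<open>\<open>B\<close> will be the set of boxes already read and \<open>f\<close> their
  entries. The sum is empty if these entries do not extend to a reverse tableau.\<close>

definition rest_sum :: "(nat \<times> nat) set \<Rightarrow> (nat \<times> nat \<Rightarrow> nat) \<Rightarrow> (nat \<Rightarrow> 'a) \<Rightarrow> 'a"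
  where "rest_sum B f x = (\<Sum>R | R \<in> reverse_tableaux d mu \<and> (\<forall>b\<in>B. R b = f b).
    \<Prod>b\<in>boxes d mu - B. factor x R b)"

lemma finite_reverse_tableaux [simp]: "finite (reverse_tableaux d mu)"
  unfolding reverse_tableaux_eq_fillings by simp

lemma rest_sum_insert:
  assumes b: "(r, c) \<in> boxes d mu" "(r, c) \<notin> B"
  shows "rest_sum B f x =
    (\<Sum>v\<in>{1..d}. (x v - y (compl_index d v + c - r)) * rest_sum (insert (r, c) B) (f((r, c) := v)) x)"
proof -
  let ?A = "\<lambda>v. {R \<in> reverse_tableaux d mu. (\<forall>b\<in>insert (r, c) B. R b = (f((r, c) := v)) b)}"
  have eq: "{R. R \<in> reverse_tableaux d mu \<and> (\<forall>b\<in>B. R b = f b)} = (\<Union>v\<in>{1..d}. ?A v)"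
    using b by (auto simp: reverse_tableaux_def)
  have "rest_sum B f x = (\<Sum>v\<in>{1..d}. \<Sum>R\<in>?A v. \<Prod>b\<in>boxes d mu - B. factor x R b)"
    unfolding rest_sum_def eq by (rule sum.UNION_disjoint) auto
  also have "\<dots> = (\<Sum>v\<in>{1..d}. (x v - y (compl_index d v + c - r)) * rest_sum (insert (r, c) B) (f((r, c) := v)) x)"
    unfolding rest_sum_def sum_distrib_left
  proof (intro sum.cong[OF refl])
    fix v R assume "R \<in> ?A v"
    then have "factor x R (r, c) = x v - y (compl_index d v + c - r)" by (simp add: factor_def)
    moreover have "boxes d mu - insert (r, c) B = boxes d mu - B - {(r, c)}" by auto
    ultimately show "(\<Prod>b\<in>boxes d mu - B. factor x R b) =
        (x v - y (compl_index d v + c - r)) * (\<Prod>b\<in>boxes d mu - insert (r, c) B. factor x R b)"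
      using b finite_boxes by (subst prod.remove[of _ "(r, c)"]) auto
  qed
  finally show ?thesis .
qed

text \<open>The unread boxes of column \<open>c\<close> lie below an entry \<open>k + 1\<close>, so
  their factors involve neither variable. A \<open>k\<close> in that column can only stand directly
  above this \<open>k + 1\<close>, so the column is \<open>swappable\<close> as a bound for the
  columns to its left.\<close>

lemma swap_invariant_rest_sum:
  assumes k: "1 \<le> k" "k < d" and b: "(r, c) \<in> boxes d mu" and f: "f (r, c) = Suc k"
    and B: "B = {b \<in> boxes d mu. before_reverse b (r, c) \<or> b = (r, c)}"
  shows "swap_invariant k (rest_sum B f)"
proof -
  have c: "0 < c" "c \<le> mu 1" using b box_le_width by (auto simp: box_iff)
  \<comment> \<open>All earlier columns have been read, so \<open>block 0 c - B\<close> is the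
    unread lower part of column \<open>c\<close>; the value 0 discards fillings that disagree with
    \<open>f\<close>.\<close>
  define G where "G x Q = (if \<forall>b\<in>B. Q b = f b then \<Prod>b\<in>block 0 c - B. factor x Q b else 0)" for x Q
  have Bc: "B \<subseteq> block 0 c" by (auto simp: B before_reverse_def block_iff box_iff)
  have split: "boxes d mu - B = (block 0 c - B) \<union> block c (mu 1)"
    using Bc c box_le_width by (auto simp: block_iff) (auto simp: box_iff block_iff)
  have G: "rest_sum B f x = (\<Sum>Q\<in>fillings 0 c (\<lambda>_. d). G x Q * tail_sum c (\<lambda>r. Q (r, c)) x)" for x
  proof -
    have "rest_sum B f x = (\<Sum>R\<in>reverse_tableaux d mu. if \<forall>b\<in>B. R b = f b then \<Prod>b\<in>boxes d mu - B. factor x R b else 0)"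
      unfolding rest_sum_def by (rule sum.inter_filter) simp
    also have "\<dots> = (\<Sum>R\<in>fillings 0 (mu 1) (\<lambda>_. d). G x (restrict R (block 0 c)) *
        (\<Prod>b\<in>block c (mu 1). factor x (restrict R (block c (mu 1))) b))"
      unfolding reverse_tableaux_eq_fillings
    proof (rule sum.cong[OF refl])
      fix R assume "R \<in> fillings 0 (mu 1) (\<lambda>_. d)"
      have 1: "(\<forall>b\<in>B. restrict R (block 0 c) b = f b) \<longleftrightarrow> (\<forall>b\<in>B. R b = f b)"
        using Bc by (auto simp: restrict_def)
      have "(\<Prod>b\<in>boxes d mu - B. factor x R b) = (\<Prod>b\<in>block 0 c - B. factor x R b) * (\<Prod>b\<in>block c (mu 1). factor x R b)"
        unfolding split by (rule prod.union_disjoint) (auto simp: block_iff)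
      also have "\<dots> = (\<Prod>b\<in>block 0 c - B. factor x (restrict R (block 0 c)) b) *
          (\<Prod>b\<in>block c (mu 1). factor x (restrict R (block c (mu 1))) b)"
        by (intro arg_cong2[where f="(*)"] prod.cong factor_cong) auto
      finally show "(if \<forall>b\<in>B. R b = f b then \<Prod>b\<in>boxes d mu - B. factor x R b else 0) =
          G x (restrict R (block 0 c)) * (\<Prod>b\<in>block c (mu 1). factor x (restrict R (block c (mu 1))) b)"
        unfolding G_def 1 by simp
    qed
    also have "\<dots> = (\<Sum>Q\<in>fillings 0 c (\<lambda>_. d). G x Q * tail_sum c (\<lambda>r. Q (r, c)) x)"
      unfolding tail_sum_def using c by (intro sum_fillings_split) auto
    finally show ?thesis .
  qed
  have inv: "swap_invariant k (\<lambda>x. G x Q * tail_sum c (\<lambda>r. Q (r, c)) x)"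
    if Q: "Q \<in> fillings 0 c (\<lambda>_. d)" for Q
  proof (cases "\<forall>b\<in>B. Q b = f b")
    case False
    then have "G x Q = 0" for x unfolding G_def by (rule if_not_P)
    then show ?thesis by (simp add: swap_invariant_def)
  next
    case True
    then have Qb: "Q (r, c) = Suc k" using b f by (auto simp: B)
    have bc: "(r, c) \<in> block 0 c" using b c by (auto simp: block_iff)
    have "swap_invariant k (\<lambda>x. \<Prod>b\<in>block 0 c - B. factor x Q b)"
    proof (intro swap_invariant_prod swap_invariant_factor)
      fix b' assume b': "b' \<in> block 0 c - B"
      obtain r' where r': "b' = (r', c)" "r' < r"
        using b' by (cases b') (auto simp: B before_reverse_def block_iff)
      then have "Suc k < Q b'" using fillings_col_less[OF Q _ bc r'(2)] b' Qb by auto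
      then show "Q b' \<noteq> k" "Q b' \<noteq> Suc k" by auto
    qed
    then have 1: "swap_invariant k (\<lambda>x. G x Q)" using True by (simp add: G_def)
    have "swappable k c (\<lambda>r. Q (r, c))"
      unfolding swappable_def
    proof (intro allI impI)
      fix r' assume *: "(r', Suc c) \<in> boxes d mu \<and> Q (r', c) = k"
      then have b': "(r', c) \<in> block 0 c"
        using box_mono[of r' "Suc c" r' c] c by (auto simp: block_iff box_iff)
      have "r < r'"
        using fillings_col_less[OF Q b' bc] Qb * by (cases r r' rule: linorder_cases) auto
      moreover have "\<not> Suc r < r'"
      proof
        assume lt: "Suc r < r'"
        then have b'': "(Suc r, c) \<in> block 0 c"
          using b' box_mono[of r' c "Suc r" c] by (auto simp: block_iff)
        show False
          using fillings_col_less[OF Q b'' b' lt] fillings_col_less[OF Q bc b''] Qb * by simp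
      qed
      ultimately have "r' = Suc r" by simp
      then show "1 < r' \<and> Q (r' - 1, c) = Suc k" using Qb b by (auto simp: box_iff)
    qed
    then have 2: "swap_invariant k (tail_sum c (\<lambda>r. Q (r, c)))"
      by (rule swap_invariant_tail_sum[OF k])
    from swap_invariant_mult[OF 1 2] show ?thesis .
  qed
  show ?thesis
    unfolding swap_invariant_def G using inv by (auto simp: swap_invariant_def)
qed

text \<open>With no box read this is the symmetry of the factorial Schur function.\<close>

lemma swap_invariant_rest_sum_empty:
  assumes "1 \<le> k" "k < d"
  shows "swap_invariant k (rest_sum {} f)"
proof -
  have "rest_sum {} f = tail_sum 0 (\<lambda>_. d)"
    by (simp add: fun_eq_iff rest_sum_def tail_sum_def reverse_tableaux_eq_fillings block_all[unfolded One_nat_def])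
  moreover have "swappable k 0 (\<lambda>_. d)" using assms by (auto simp: swappable_def)
  ultimately show ?thesis using swap_invariant_tail_sum[OF assms] by metis
qed

lemma set_reverse_reading: "set (reverse_reading d mu) = boxes d mu"
proof (rule set_eqI)
  fix b :: "nat \<times> nat"
  obtain r c where b: "b = (r, c)" by (cases b)
  have "c < Suc (mu (Suc 0))" if "Suc 0 \<le> r" "r \<le> d" "Suc 0 \<le> c" "c \<le> mu r"
    using box_le_width[of r c] that by (auto simp: box_iff)
  then show "b \<in> set (reverse_reading d mu) \<longleftrightarrow> b \<in> boxes d mu"
    by (auto simp: reverse_reading_def box_iff b simp del: upt_Suc)
qed

abbreviation reading :: "(nat \<times> nat) list"
  where "reading \<equiv> reverse_reading d mu"

definition entries :: "entry set"
  where "entries = Unbarred ` {1..d} \<union> Barred ` {1..d}"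

lemma sum_entries: "(\<Sum>e\<in>entries. F e) = (\<Sum>v\<in>{1..d}. F (Unbarred v) + F (Barred v))"
proof -
  have "(\<Sum>e\<in>entries. F e) = (\<Sum>e\<in>Unbarred ` {1..d}. F e) + (\<Sum>e\<in>Barred ` {1..d}. F e)"
    unfolding entries_def by (rule sum.union_disjoint) auto
  then show ?thesis by (simp add: sum.reindex inj_on_def sum.distrib)
qed

definition prefix_word :: "nat list \<Rightarrow> nat \<Rightarrow> (nat \<times> nat \<Rightarrow> entry) \<Rightarrow> nat list"
  where "prefix_word w n U = w @ unbarred_entries U (take n reading)"

text \<open>The counterpart of \<open>weight_factor\<close> over \<open>'a\<close>, with an
  arbitrary word \<open>w\<close> in place of the word of the first shape.\<close>

definition bar_factor :: "nat list \<Rightarrow> (nat \<times> nat \<Rightarrow> entry) \<Rightarrow> nat \<times> nat \<Rightarrow> 'a"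
  where "bar_factor w U = (\<lambda>(r, c). let a = entry_val (U (r, c)) in
    y (compl_index d a + content (w @ unbarred_entries U (takeWhile (\<lambda>b. b \<noteq> (r, c)) reading)) a)
    - y (compl_index d a + c - r))"

definition bar_weight :: "nat list \<Rightarrow> nat \<Rightarrow> (nat \<times> nat \<Rightarrow> entry) \<Rightarrow> 'a"
  where "bar_weight w n U = (\<Prod>b | b \<in> set (take n reading) \<and> is_barred (U b). bar_factor w U b)"

text \<open>The state of the expansion after \<open>n\<close> boxes. For \<open>n = 0\<close> it is
  the antisymmetrized product to be expanded; after the last box it is a pure alternant if
  \<open>U\<close> satisfies the tableau conditions, and 0 otherwise.\<close>

definition alternant :: "nat list \<Rightarrow> nat \<Rightarrow> (nat \<times> nat \<Rightarrow> entry) \<Rightarrow> (nat \<Rightarrow> 'a) \<Rightarrow> 'a"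
  where "alternant w n U = antisymmetrize d (\<lambda>x. monom (exponent (prefix_word w n U)) x *
    rest_sum (set (take n reading)) (entry_val \<circ> U) x)"

text \<open>A factor depends only on entries read up to its own box, so it is final as soon as that
  box is filled.\<close>

lemma bar_factor_cong:
  assumes "n < length reading" "\<And>b. b \<in> set (take (Suc n) reading) \<Longrightarrow> U b = U' b"
  shows "bar_factor w U (reading ! n) = bar_factor w U' (reading ! n)"
proof -
  have "unbarred_entries U (take n reading) = unbarred_entries U' (take n reading)"
    using assms(2) set_take_subset_set_take[of n "Suc n" reading] by (intro unbarred_entries_cong) auto
  moreover have "U (reading ! n) = U' (reading ! n)"
    using assms by (simp add: take_Suc_conv_app_nth)
  ultimately show ?thesis
    using takeWhile_neq_nth[OF distinct_reverse_reading assms(1)]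
    by (cases "reading ! n") (auto simp: bar_factor_def)
qed

lemma prefix_word_update:
  assumes "n < length reading"
  shows "prefix_word w (Suc n) (U(reading ! n := e)) =
    (if is_barred e then prefix_word w n U else prefix_word w n U @ [entry_val e])"
proof -
  have "reading ! n \<notin> set (take n reading)"
    using nth_notin_take[OF distinct_reverse_reading assms] .
  then have "unbarred_entries (U(reading ! n := e)) (take n reading) = unbarred_entries U (take n reading)"
    by (intro unbarred_entries_cong) auto
  then show ?thesis
    using assms by (simp add: prefix_word_def take_Suc_conv_app_nth unbarred_entries_append unbarred_entries_single)
qed

lemma bar_weight_update:
  assumes n: "n < length reading" and b: "reading ! n = (r, c)"
  shows "bar_weight w (Suc n) (U((r, c) := e)) = (if is_barred e
    then (y (compl_index d (entry_val e) + content (prefix_word w n U) (entry_val e))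
        - y (compl_index d (entry_val e) + c - r)) * bar_weight w n U
    else bar_weight w n U)"
proof -
  let ?U = "U((r, c) := e)" and ?B = "set (take n reading)"
  have notin: "(r, c) \<notin> ?B"
    using nth_notin_take[OF distinct_reverse_reading n] b by simp
  have old: "bar_factor w ?U b' = bar_factor w U b'" if b': "b' \<in> ?B" for b'
  proof -
    obtain i where i: "i < n" "b' = reading ! i"
      using b' n by (auto simp: in_set_conv_nth)
    have "set (take (Suc i) reading) \<subseteq> ?B" using i by (intro set_take_subset_set_take) simp
    then show ?thesis using i n notin by (auto intro!: bar_factor_cong)
  qed
  have word: "unbarred_entries ?U (take n reading) = unbarred_entries U (take n reading)"
    using notin by (intro unbarred_entries_cong) auto
  have new: "bar_factor w ?U (r, c) = y (compl_index d (entry_val e) + content (prefix_word w n U) (entry_val e))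
        - y (compl_index d (entry_val e) + c - r)"
    using takeWhile_neq_nth[OF distinct_reverse_reading n] word
    by (simp add: bar_factor_def prefix_word_def b Let_def)
  have set: "{b'. b' \<in> set (take (Suc n) reading) \<and> is_barred (?U b')} =
      (if is_barred e then insert (r, c) else id) {b' \<in> ?B. is_barred (U b')}"
    using n b notin by (auto simp: take_Suc_conv_app_nth)
  have "bar_weight w n U = (\<Prod>b | b \<in> ?B \<and> is_barred (U b). bar_factor w ?U b)"
    unfolding bar_weight_def by (rule prod.cong) (auto simp: old)
  then show ?thesis
    unfolding bar_weight_def[of w "Suc n"] set using notin new by simp
qed

text \<open>Just before the violation, \<open>k\<close> and \<open>k + 1\<close> occur equally
  often. One more \<open>k + 1\<close> offsets the step of the staircase and makes the two exponents
  equal; the same letter is the entry \<open>k + 1\<close> that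
  \<open>swap_invariant_rest_sum\<close> asks for.\<close>

lemma alternant_eq_0:
  assumes n: "n < length reading" and w: "yamanouchi d (prefix_word w n U)"
    and v: "v \<in> {1..d}" and not: "\<not> yamanouchi d (prefix_word w n U @ [v])"
  shows "alternant w (Suc n) (U(reading ! n := Unbarred v)) x = 0"
proof -
  let ?w = "prefix_word w n U"
  obtain k where k: "1 \<le> k" "k < d" and lt: "content (?w @ [v]) k < content (?w @ [v]) (Suc k)"
    using w not unfolding yamanouchi_snoc by (auto simp: not_le)
  with yamanouchi_content_Suc[OF w k] have vk: "v = Suc k" and eq: "content ?w (Suc k) = content ?w k"
    by (auto split: if_splits)
  obtain r c where rc: "reading ! n = (r, c)" by (cases "reading ! n")
  have mem: "(r, c) \<in> boxes d mu" using nth_mem[OF n] rc by (simp add: set_reverse_reading)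
  have "swap_invariant k (monom (exponent (prefix_word w (Suc n) (U(reading ! n := Unbarred v)))))"
    using eq k by (intro swap_invariant_monom) (auto simp: prefix_word_update[OF n] exponent_def vk)
  moreover have "swap_invariant k (rest_sum (set (take (Suc n) reading)) (entry_val \<circ> U(reading ! n := Unbarred v)))"
  proof (rule swap_invariant_rest_sum[OF k mem])
    show "(entry_val \<circ> U(reading ! n := Unbarred v)) (r, c) = Suc k" by (simp add: rc vk)
    have "set (take n reading) = {b \<in> boxes d mu. before_reverse b (r, c)}"
      using set_take_sorted_wrt[OF sorted_wrt_reverse_reading before_reverse_asym n]
      by (simp add: rc set_reverse_reading)
    then show "set (take (Suc n) reading) = {b \<in> boxes d mu. before_reverse b (r, c) \<or> b = (r, c)}"
      using n rc mem by (auto simp: take_Suc_conv_app_nth)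
  qed
  ultimately show ?thesis
    unfolding alternant_def by (intro antisymmetrize_swap_invariant[OF _ k] swap_invariant_mult)
qed

lemma alternant_step:
  assumes n: "n < length reading" and b: "reading ! n = (r, c)"
  shows "alternant w n U x = (\<Sum>v\<in>{1..d}. alternant w (Suc n) (U((r, c) := Unbarred v)) x +
    (y (compl_index d v + content (prefix_word w n U) v) - y (compl_index d v + c - r)) *
      alternant w (Suc n) (U((r, c) := Barred v)) x)"
proof -
  let ?B = "set (take n reading)" and ?\<beta> = "exponent (prefix_word w n U)"
  define Z where "Z v = y (compl_index d v + c - r)" for v
  define f where "f v = (entry_val \<circ> U)((r, c) := v)" for v
  define S where "S v x = rest_sum (insert (r, c) ?B) (f v) x" for v x
  have mem: "(r, c) \<in> boxes d mu" using nth_mem[OF n] b by (simp add: set_reverse_reading)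
  have notin: "(r, c) \<notin> ?B"
    using nth_notin_take[OF distinct_reverse_reading n] b by simp
  have Suc: "set (take (Suc n) reading) = insert (r, c) ?B"
    using n b by (simp add: take_Suc_conv_app_nth)
  have "monom ?\<beta> x * rest_sum ?B (entry_val \<circ> U) x =
      (\<Sum>v\<in>{1..d}. monom (?\<beta>(v := Suc (?\<beta> v))) x * S v x + (y (Suc (?\<beta> v)) - Z v) * (monom ?\<beta> x * S v x))" for x
  proof -
    have "monom ?\<beta> x * rest_sum ?B (entry_val \<circ> U) x = (\<Sum>v\<in>{1..d}. (monom ?\<beta> x * (x v - Z v)) * S v x)"
      unfolding rest_sum_insert[OF mem notin] sum_distrib_left Z_def S_def f_def by (simp add: mult_ac)
    also have "\<dots> = (\<Sum>v\<in>{1..d}. monom (?\<beta>(v := Suc (?\<beta> v))) x * S v x + (y (Suc (?\<beta> v)) - Z v) * (monom ?\<beta> x * S v x))"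
      by (intro sum.cong refl, subst monom_mult) (auto simp: distrib_right mult.assoc)
    finally show ?thesis .
  qed
  then have "alternant w n U x = (\<Sum>v\<in>{1..d}. antisymmetrize d (\<lambda>x. monom (?\<beta>(v := Suc (?\<beta> v))) x * S v x) x +
      (y (Suc (?\<beta> v)) - Z v) * antisymmetrize d (\<lambda>x. monom ?\<beta> x * S v x) x)"
    unfolding alternant_def by (simp add: antisymmetrize_sum antisymmetrize_add antisymmetrize_scale)
  also have "\<dots> = (\<Sum>v\<in>{1..d}. alternant w (Suc n) (U((r, c) := Unbarred v)) x +
    (y (compl_index d v + content (prefix_word w n U) v) - y (compl_index d v + c - r)) *
      alternant w (Suc n) (U((r, c) := Barred v)) x)"
  proof (intro sum.cong refl)
    fix v assume v: "v \<in> {1..d}"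
    \<comment> \<open>This is the origin of the index \<open>|a|' + \<omega>\<close> in the weight:
      it is the position of the next factor of the falling product.\<close>
    have 1: "Suc (?\<beta> v) = compl_index d v + content (prefix_word w n U) v"
      using v by (simp add: exponent_def compl_index_def Suc_diff_le)
    have 2: "entry_val \<circ> U((r, c) := Unbarred v) = f v" "entry_val \<circ> U((r, c) := Barred v) = f v"
      by (auto simp: f_def fun_eq_iff)
    show "antisymmetrize d (\<lambda>x. monom (?\<beta>(v := Suc (?\<beta> v))) x * S v x) x +
        (y (Suc (?\<beta> v)) - Z v) * antisymmetrize d (\<lambda>x. monom ?\<beta> x * S v x) x =
      alternant w (Suc n) (U((r, c) := Unbarred v)) x +
      (y (compl_index d v + content (prefix_word w n U) v) - y (compl_index d v + c - r)) *
      alternant w (Suc n) (U((r, c) := Barred v)) x"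
      unfolding alternant_def 1 2 Suc S_def Z_def
      using prefix_word_update[OF n, of w U "Unbarred v"] prefix_word_update[OF n, of w U "Barred v"]
      by (simp add: b exponent_snoc 1)
  qed
  finally show ?thesis .
qed

text \<open>Fillings need not be tableaux here; the others are removed by an empty
  \<open>rest_sum\<close>. The Yamanouchi filter fits the recursion: a word that violates the
  condition keeps violating it, and a new violation comes with a vanishing alternant.
  \<open>U0\<close> is arbitrary because no box has been read at stage 0.\<close>

lemma alternant_expansion:
  assumes w: "yamanouchi d w" and "n \<le> length reading"
  shows "alternant w 0 U0 x = (\<Sum>U | U \<in> set (take n reading) \<rightarrow>\<^sub>E entries \<and> yamanouchi d (prefix_word w n U).
    bar_weight w n U * alternant w n U x)"
proof -
  define T where "T n U = (if yamanouchi d (prefix_word w n U) then bar_weight w n U * alternant w n U x else 0)" for n U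
  have fin: "finite (set (take n reading) \<rightarrow>\<^sub>E entries)" for n
    by (rule finite_PiE) (auto simp: entries_def)
  have "alternant w 0 U0 x = (\<Sum>U\<in>set (take n reading) \<rightarrow>\<^sub>E entries. T n U)"
    using assms(2)
  proof (induction n)
    case 0
    then show ?case
      using w by (simp add: T_def prefix_word_def bar_weight_def alternant_def rest_sum_def)
  next
    case (Suc n)
    then have n: "n < length reading" by simp
    let ?B = "set (take n reading)"
    obtain r c where b: "reading ! n = (r, c)" by (cases "reading ! n")
    have notin: "(r, c) \<notin> ?B"
      using nth_notin_take[OF distinct_reverse_reading n] b by simp
    have B: "set (take (Suc n) reading) = insert (r, c) ?B"
      using n b by (simp add: take_Suc_conv_app_nth)
    have step: "T n U = (\<Sum>e\<in>entries. T (Suc n) (U((r, c) := e)))" for U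
    proof (cases "yamanouchi d (prefix_word w n U)")
      case False
      then have "\<not> yamanouchi d (prefix_word w (Suc n) (U((r, c) := e)))" for e
        using prefix_word_update[OF n, of w U e] yamanouchi_snoc[of d "prefix_word w n U"] b by auto
      then show ?thesis using False by (simp add: T_def)
    next
      case True
      have 1: "T (Suc n) (U((r, c) := Unbarred v)) = bar_weight w n U * alternant w (Suc n) (U((r, c) := Unbarred v)) x"
        if "v \<in> {1..d}" for v
        using alternant_eq_0[OF n True that] prefix_word_update[OF n, of w U "Unbarred v"]
        by (simp add: T_def b bar_weight_update[OF n b])
      have 2: "T (Suc n) (U((r, c) := Barred v)) = bar_weight w n U *
        ((y (compl_index d v + content (prefix_word w n U) v) - y (compl_index d v + c - r)) *
          alternant w (Suc n) (U((r, c) := Barred v)) x)" for v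
        using True prefix_word_update[OF n, of w U "Barred v"]
        by (simp add: T_def b bar_weight_update[OF n b])
      have "T n U = bar_weight w n U * alternant w n U x" using True by (simp add: T_def)
      also have "\<dots> = (\<Sum>v\<in>{1..d}. T (Suc n) (U((r, c) := Unbarred v)) + T (Suc n) (U((r, c) := Barred v)))"
        unfolding alternant_step[OF n b] sum_distrib_left
        by (intro sum.cong refl) (simp only: 1 2 distrib_left)
      finally show ?thesis by (simp only: sum_entries)
    qed
    have "alternant w 0 U0 x = (\<Sum>U\<in>?B \<rightarrow>\<^sub>E entries. T n U)" using Suc by simp
    also have "\<dots> = (\<Sum>U\<in>set (take (Suc n) reading) \<rightarrow>\<^sub>E entries. T (Suc n) U)"
      unfolding B sum_PiE_insert[OF notin] by (rule sum.cong[OF refl step])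
    finally show ?case .
  qed
  also have "\<dots> = (\<Sum>U | U \<in> set (take n reading) \<rightarrow>\<^sub>E entries \<and> yamanouchi d (prefix_word w n U).
      bar_weight w n U * alternant w n U x)"
    unfolding T_def using fin[of n] by (rule sum.inter_filter[symmetric])
  finally show ?thesis .
qed

definition schur :: "(nat \<Rightarrow> 'a) \<Rightarrow> 'a"
  where "schur x = (\<Sum>R\<in>reverse_tableaux d mu. \<Prod>b\<in>boxes d mu. factor x R b)"

lemma schur_permute:
  assumes "p permutes {1..d}"
  shows "schur (x \<circ> p) = schur x"
proof (rule permutation_invariant[OF _ assms])
  fix k assume "1 \<le> k" "k < d"
  then have "swap_invariant k (rest_sum {} undefined)" by (rule swap_invariant_rest_sum_empty)
  then show "swap_invariant k schur" by (simp add: rest_sum_def schur_def swap_invariant_def)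
qed

text \<open>Symmetry moves \<open>schur\<close> inside the antisymmetrization, which is the initial
  state of the expansion; in the final state \<open>rest_sum\<close> is the indicator of the tableau
  condition.\<close>

lemma bar_expansion:
  assumes w: "yamanouchi d w"
  shows "antisymmetrize d (monom (exponent w)) x * schur x =
    (\<Sum>U | U \<in> boxes d mu \<rightarrow>\<^sub>E entries \<and> reverse_tableau_cond d mu (entry_val \<circ> U) \<and>
        yamanouchi d (w @ unbarred_entries U reading).
      (\<Prod>b | b \<in> boxes d mu \<and> is_barred (U b). bar_factor w U b) *
      antisymmetrize d (monom (exponent (w @ unbarred_entries U reading))) x)"
proof -
  let ?N = "length reading"
  let ?Y = "{U. U \<in> boxes d mu \<rightarrow>\<^sub>E entries \<and> yamanouchi d (w @ unbarred_entries U reading)}"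
  have fin: "finite ?Y"
    by (rule finite_subset[of _ "boxes d mu \<rightarrow>\<^sub>E entries"]) (auto intro: finite_PiE finite_boxes simp: entries_def)
  have rest: "rest_sum {} f = schur" for f :: "nat \<times> nat \<Rightarrow> nat"
    by (simp add: fun_eq_iff rest_sum_def schur_def)
  have full: "rest_sum (boxes d mu) (entry_val \<circ> U) x =
      (if reverse_tableau_cond d mu (entry_val \<circ> U) then 1 else 0)"
    if U: "U \<in> boxes d mu \<rightarrow>\<^sub>E entries" for U x
  proof -
    let ?f = "restrict (entry_val \<circ> U) (boxes d mu)"
    have val: "entry_val (U b) \<in> {1..d}" if "b \<in> boxes d mu" for b
      using PiE_mem[OF U that] by (auto simp: entries_def)
    have "{R. R \<in> reverse_tableaux d mu \<and> (\<forall>b\<in>boxes d mu. R b = (entry_val \<circ> U) b)} =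
        (if ?f \<in> reverse_tableaux d mu then {?f} else {})"
    proof -
      have uniq: "R = ?f" if "R \<in> reverse_tableaux d mu" and "\<forall>b\<in>boxes d mu. R b = (entry_val \<circ> U) b" for R
      proof (rule extensionalityI[of _ "boxes d mu"])
        show "R \<in> extensional (boxes d mu)" using that(1) by (simp add: reverse_tableaux_def PiE_def)
        show "R b = ?f b" if "b \<in> boxes d mu" for b
          using bspec[OF \<open>\<forall>b\<in>boxes d mu. R b = (entry_val \<circ> U) b\<close> that] that by simp
      qed simp
      have "{R. R \<in> reverse_tableaux d mu \<and> (\<forall>b\<in>boxes d mu. R b = (entry_val \<circ> U) b)} =
          {?f} \<inter> reverse_tableaux d mu"
      proof (intro equalityI subsetI)
        fix R assume "R \<in> {R. R \<in> reverse_tableaux d mu \<and> (\<forall>b\<in>boxes d mu. R b = (entry_val \<circ> U) b)}"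
        then show "R \<in> {?f} \<inter> reverse_tableaux d mu" using uniq[of R] by blast
      qed simp
      then show ?thesis by simp
    qed
    moreover have "?f \<in> reverse_tableaux d mu \<longleftrightarrow> reverse_tableau_cond d mu (entry_val \<circ> U)"
      using val reverse_valid_cong[of "boxes d mu" ?f "entry_val \<circ> U"]
      by (auto simp: reverse_tableaux_def reverse_valid_boxes[symmetric])
    ultimately show ?thesis by (simp add: rest_sum_def)
  qed
  have "antisymmetrize d (monom (exponent w)) x * schur x = alternant w 0 (\<lambda>_. undefined) x"
    unfolding antisymmetrize_def sum_distrib_right alternant_def
    by (intro sum.cong refl) (simp add: prefix_word_def rest schur_permute mult.assoc)
  also have "\<dots> = (\<Sum>U\<in>?Y. bar_weight w ?N U * alternant w ?N U x)"
    using alternant_expansion[OF w order.refl] by (simp add: prefix_word_def set_reverse_reading)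
  also have "\<dots> = (\<Sum>U\<in>?Y. if reverse_tableau_cond d mu (entry_val \<circ> U) then
      (\<Prod>b | b \<in> boxes d mu \<and> is_barred (U b). bar_factor w U b) *
      antisymmetrize d (monom (exponent (w @ unbarred_entries U reading))) x else 0)"
    by (rule sum.cong[OF refl])
      (auto simp: bar_weight_def alternant_def set_reverse_reading prefix_word_def full antisymmetrize_def)
  also have "\<dots> = (\<Sum>U\<in>{U\<in>?Y. reverse_tableau_cond d mu (entry_val \<circ> U)}.
      (\<Prod>b | b \<in> boxes d mu \<and> is_barred (U b). bar_factor w U b) *
      antisymmetrize d (monom (exponent (w @ unbarred_entries U reading))) x)"
    using fin by (rule sum.inter_filter[symmetric])
  also have "{U\<in>?Y. reverse_tableau_cond d mu (entry_val \<circ> U)} =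
      {U. U \<in> boxes d mu \<rightarrow>\<^sub>E entries \<and> reverse_tableau_cond d mu (entry_val \<circ> U) \<and>
        yamanouchi d (w @ unbarred_entries U reading)}" by auto
  finally show ?thesis .
qed

end

subsection \<open>Vanishing weights and the bialternant formula\<close>

text \<open>\<open>\<phi>\<close> matches the letters \<open>k + 1\<close> injectively with earlier
  letters \<open>k\<close>, so no prefix contains more of the former.\<close>

lemma yamanouchi_map:
  assumes s: "sorted_wrt P bs" and asym: "\<And>a b. P a b \<Longrightarrow> \<not> P b a" and inj: "inj_on \<phi> (set bs)"
    and step: "\<And>b k. b \<in> set bs \<Longrightarrow> 1 \<le> k \<Longrightarrow> T b = Suc k \<Longrightarrow> \<phi> b \<in> set bs \<and> P (\<phi> b) b \<and> T (\<phi> b) = k"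
  shows "yamanouchi d (map T bs)"
  unfolding yamanouchi_def
proof (intro allI impI)
  fix n k assume n: "n \<le> length (map T bs)" and k: "1 \<le> k \<and> k < d"
  have dist: "distinct (take n bs)" using s asym by (intro distinct_take distinct_sorted_wrt) auto
  have sub: "\<phi> b \<in> {b \<in> set (take n bs). T b = k}" if b: "b \<in> {b \<in> set (take n bs). T b = Suc k}" for b
  proof -
    from b obtain i where i: "i < n" "i < length bs" "b = bs ! i" by (auto simp: in_set_conv_nth)
    have \<phi>: "\<phi> b \<in> set bs" "P (\<phi> b) b" "T (\<phi> b) = k"
      using step[of b k] b k in_set_takeD[of b n bs] by auto
    then obtain j where j: "j < length bs" "\<phi> b = bs ! j" by (auto simp: in_set_conv_nth)
    have "\<not> i < j" using s \<phi>(2) asym i j by (auto simp: sorted_wrt_iff_nth_less)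
    then have "j < n" using i by simp
    then show ?thesis using \<phi> j by (auto simp: in_set_conv_nth)
  qed
  have "card {b \<in> set (take n bs). T b = Suc k} \<le> card {b \<in> set (take n bs). T b = k}"
  proof (rule card_inj_on_le)
    show "inj_on \<phi> {b \<in> set (take n bs). T b = Suc k}"
      using inj by (rule inj_on_subset) (auto dest: in_set_takeD)
    show "\<phi> ` {b \<in> set (take n bs). T b = Suc k} \<subseteq> {b \<in> set (take n bs). T b = k}" using sub by blast
  qed simp
  then show "content (take n (map T bs)) (k + 1) \<le> content (take n (map T bs)) k"
    by (simp add: take_map content_map[OF dist])
qed

lemma down_closed_eq_atLeastAtMost:
  fixes S :: "nat set"
  assumes "finite S" "0 \<notin> S" and down: "\<And>i j. i \<in> S \<Longrightarrow> 1 \<le> j \<Longrightarrow> j \<le> i \<Longrightarrow> j \<in> S"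
  shows "S = {1..card S}"
proof (cases "S = {}")
  case False
  have eq: "S = {1..Max S}"
  proof (intro equalityI subsetI)
    fix i assume "i \<in> S"
    then have "i \<noteq> 0" "i \<le> Max S" using assms(1,2) by (metis, simp)
    then show "i \<in> {1..Max S}" by simp
  next
    fix i assume "i \<in> {1..Max S}"
    then show "i \<in> S" using down[of "Max S" i] Max_in[OF assms(1) False] by simp
  qed
  from arg_cong[OF this, of card] have "card S = Max S" by simp
  with eq show ?thesis by simp
qed simp

text \<open>Each step loses at least one, and the range leaves room for exactly one per
  step.\<close>

lemma strict_antimono_eq_reverse:
  fixes f :: "nat \<Rightarrow> nat"
  assumes less: "\<And>i j. 1 \<le> i \<Longrightarrow> i < j \<Longrightarrow> j \<le> h \<Longrightarrow> f j < f i"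
    and range: "\<And>i. 1 \<le> i \<Longrightarrow> i \<le> h \<Longrightarrow> 1 \<le> f i \<and> f i \<le> h" and i: "1 \<le> i" "i \<le> h"
  shows "f i = h + 1 - i"
proof -
  have "f i + i \<le> h + 1" using i
  proof (induction i rule: dec_induct)
    case base
    then show ?case using range[of 1] by simp
  next
    case (step n)
    then show ?case using less[of n "Suc n"] by simp
  qed
  moreover have "h + 1 \<le> f i + i" using i(2,1)
  proof (induction i rule: inc_induct)
    case base
    then show ?case using range[of h] by simp
  next
    case (step n)
    then show ?case using less[of n "Suc n"] by simp
  qed
  ultimately show ?thesis by simp
qed

definition before_young :: "nat \<times> nat \<Rightarrow> nat \<times> nat \<Rightarrow> bool"
  where "before_young = (\<lambda>(i, j) (i', j'). j' < j \<or> j = j' \<and> i < i')"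

lemma before_young_asym: "before_young b b' \<Longrightarrow> \<not> before_young b' b"
  by (auto simp: before_young_def)

lemma sorted_wrt_young_reading: "sorted_wrt before_young (young_reading d la)"
proof -
  have col: "sorted_wrt before_young (concat (map (\<lambda>i. if j \<le> la i then [(i, j)] else []) [1..<d + 1]))" for j
    by (rule sorted_wrt_concat_map[where P = "(<)"])
      (auto simp: before_young_def simp del: upt_Suc split: if_splits)
  show ?thesis
    unfolding young_reading_def
    by (rule sorted_wrt_concat_map[where P = "\<lambda>j j'. j' < j"], simp add: sorted_wrt_rev del: upt_Suc, rule col)
      (auto simp: before_young_def split: if_splits)
qed

lemma distinct_young_reading: "distinct (young_reading d la)"
  using sorted_wrt_young_reading by (rule distinct_sorted_wrt) (auto simp: before_young_def)

context shape
begin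

lemma set_young_reading: "set (young_reading d mu) = boxes d mu"
proof (rule set_eqI)
  fix b :: "nat \<times> nat"
  obtain r c where b: "b = (r, c)" by (cases b)
  have "c < Suc (mu (Suc 0))" if "Suc 0 \<le> r" "r \<le> d" "Suc 0 \<le> c" "c \<le> mu r"
    using box_le_width[of r c] that by (auto simp: box_iff)
  then show "b \<in> set (young_reading d mu) \<longleftrightarrow> b \<in> boxes d mu"
    by (auto simp: young_reading_def box_iff b simp del: upt_Suc)
qed

text \<open>The only filling of the first shape that can occur in \<open>LR\<close>, by
  \<open>yamanouchi_imp_superstandard\<close>.\<close>

definition superstandard :: "nat \<times> nat \<Rightarrow> nat"
  where "superstandard = restrict fst (boxes d mu)"

lemma superstandard_tableau:
  "superstandard \<in> boxes d mu \<rightarrow>\<^sub>E {1..d}" "tableau_cond d mu superstandard"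
  by (auto simp: superstandard_def tableau_cond_def box_iff)

lemma map_superstandard: "map superstandard (young_reading d mu) = map fst (young_reading d mu)"
  by (simp add: superstandard_def set_young_reading)

text \<open>The box directly above an entry \<open>k + 1\<close> holds \<open>k\<close> and is read
  earlier.\<close>

lemma yamanouchi_superstandard: "yamanouchi d (map superstandard (young_reading d mu))"
  unfolding map_superstandard
proof (rule yamanouchi_map[OF sorted_wrt_young_reading before_young_asym])
  show "inj_on (\<lambda>(i, j). (i - 1, j)) (set (young_reading d mu))"
    unfolding set_young_reading by (auto simp: inj_on_def box_iff)
next
  fix b k assume *: "b \<in> set (young_reading d mu)" "1 \<le> k" "fst b = Suc k"
  then obtain j where b: "b = (Suc k, j)" by (metis prod.collapse)
  then show "(case b of (i, j) \<Rightarrow> (i - 1, j)) \<in> set (young_reading d mu) \<and>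
      before_young (case b of (i, j) \<Rightarrow> (i - 1, j)) b \<and> fst (case b of (i, j) \<Rightarrow> (i - 1, j)) = k"
    using * box_mono[of "Suc k" j k j] by (auto simp: set_young_reading before_young_def box_iff)
qed

lemma content_superstandard: "content (map superstandard (young_reading d mu)) k = mu k"
proof -
  have "{b \<in> boxes d mu. fst b = k} = (if k \<in> {1..d} then Pair k ` {1..mu k} else {})"
    by (auto simp: boxes_def)
  moreover have "mu k = 0" if "k \<notin> {1..d}" using mu that by (auto simp: partitions_def)
  ultimately show ?thesis
    unfolding map_superstandard content_map[OF distinct_young_reading] set_young_reading
    by (auto simp: card_image inj_on_def)
qed

text \<open>Induction along the reading. Column strictness makes the entry in row \<open>i\<close>
  at least \<open>i\<close>. Suppose it is \<open>v + 1\<close> with \<open>v \<ge> i\<close>. A box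
  to its right would already hold \<open>i\<close>, so its box ends row \<open>i\<close>. The
  Yamanouchi condition supplies an earlier \<open>v\<close>, which by induction lies in row
  \<open>v\<close> and further right; so row \<open>v\<close> is longer than row \<open>i\<close>, a
  contradiction.\<close>

lemma yamanouchi_imp_superstandard:
  assumes T: "T \<in> boxes d mu \<rightarrow>\<^sub>E {1..d}" "tableau_cond d mu T"
    and yam: "yamanouchi d (map T (young_reading d mu))"
  shows "T = superstandard"
proof -
  let ?bs = "young_reading d mu"
  have eq: "T (?bs ! n) = fst (?bs ! n)" if "n < length ?bs" for n
    using that
  proof (induction n rule: less_induct)
    case (less n)
    obtain i j where b: "?bs ! n = (i, j)" by (cases "?bs ! n")
    have mem: "(i, j) \<in> boxes d mu" using nth_mem[OF less.prems] b by (simp add: set_young_reading)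
    have tk: "set (take n ?bs) = {b' \<in> boxes d mu. before_young b' (i, j)}"
      using set_take_sorted_wrt[OF sorted_wrt_young_reading before_young_asym less.prems]
      by (simp add: b set_young_reading)
    have IH: "T b' = fst b'" if "b' \<in> boxes d mu" "before_young b' (i, j)" for b'
    proof -
      have "b' \<in> set (take n ?bs)" using that tk by simp
      then obtain m where "m < n" "b' = ?bs ! m" using less.prems by (auto simp: in_set_conv_nth)
      then show ?thesis using less.IH[of m] less.prems by simp
    qed
    have ge: "i \<le> T (i, j)"
    proof (cases "i = 1")
      case True
      then show ?thesis using PiE_mem[OF T(1) mem] by simp
    next
      case False
      then have m: "(i - 1, j) \<in> boxes d mu" "before_young (i - 1, j) (i, j)" "i - 1 < i"
        using mem box_mono[of i j "i - 1" j] by (auto simp: box_iff before_young_def)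
      then have "T (i - 1, j) < T (i, j)" using T(2) mem by (auto simp: tableau_cond_def)
      then show ?thesis using IH[OF m(1,2)] by simp
    qed
    have "\<not> i < T (i, j)"
    proof
      assume lt: "i < T (i, j)"
      define v where "v = T (i, j) - 1"
      have v: "T (i, j) = Suc v" "i \<le> v" "1 \<le> v" "v < d"
        using lt PiE_mem[OF T(1) mem] mem by (auto simp: v_def box_iff)
      have "(i, Suc j) \<notin> boxes d mu"
      proof
        assume m: "(i, Suc j) \<in> boxes d mu"
        then have "T (i, j) \<le> T (i, Suc j)" using T(2) mem by (auto simp: tableau_cond_def)
        moreover have "T (i, Suc j) = i" using IH[OF m] by (simp add: before_young_def)
        ultimately show False using lt by simp
      qed
      then have j: "mu i = j" using mem by (auto simp: box_iff)
      let ?w = "map T (take (Suc n) ?bs)"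
      have "?w @ map T (drop (Suc n) ?bs) = map T ?bs"
        unfolding map_append[symmetric] append_take_drop_id ..
      then have "yamanouchi d ?w" using yam yamanouchi_appendD by metis
      from yamanouchi_content_Suc[OF this v(3,4)]
      have "content ?w (Suc v) \<le> content ?w v" .
      moreover have "content ?w (Suc v) \<ge> 1"
        using less.prems by (simp add: take_Suc_conv_app_nth b v)
      ultimately have "content ?w v \<noteq> 0" by simp
      then have "v \<in> set ?w" by (auto simp: content_def count_list_0_iff)
      then have "v \<in> T ` (set (take n ?bs))"
        using less.prems v by (auto simp: take_Suc_conv_app_nth b)
      then obtain b' where b': "b' \<in> boxes d mu" "before_young b' (i, j)" "T b' = v"
        unfolding tk by auto
      then have "fst b' = v" using IH by simp
      then obtain j' where "b' = (v, j')" by (cases b') auto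
      then have "j < j'" "j' \<le> mu v" "v \<le> d" using b' v by (auto simp: before_young_def box_iff)
      then show False using j mu_antimono[of i v] v mem by (auto simp: box_iff)
    qed
    then show ?case using ge by (simp add: b)
  qed
  show ?thesis
  proof (rule extensionalityI[of _ "boxes d mu"])
    show "T \<in> extensional (boxes d mu)" using T by (simp add: PiE_def)
    show "superstandard \<in> extensional (boxes d mu)" by (simp add: superstandard_def)
    fix b assume b: "b \<in> boxes d mu"
    then obtain n where "n < length ?bs" "b = ?bs ! n"
      unfolding set_young_reading[symmetric] by (auto simp: in_set_conv_nth)
    then show "T b = superstandard b" using eq[of n] b by (simp add: superstandard_def)
  qed
qed

definition word_before :: "nat list \<Rightarrow> (nat \<times> nat \<Rightarrow> entry) \<Rightarrow> nat \<times> nat \<Rightarrow> nat list"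
  where "word_before w U b = w @ unbarred_entries U (takeWhile (\<lambda>b'. b' \<noteq> b) reading)"

text \<open>Counting by position allows the words before two different boxes to be compared by
  inclusion.\<close>

lemma content_word_before:
  assumes "b \<in> boxes d mu"
  shows "content (word_before w U b) k =
    content w k + card {b' \<in> boxes d mu. before_reverse b' b \<and> U b' = Unbarred k}"
proof -
  obtain n where n: "n < length reading" "b = reading ! n"
    using assms unfolding set_reverse_reading[symmetric] by (auto simp: in_set_conv_nth)
  have "content (unbarred_entries U (take n reading)) k = card {b' \<in> set (take n reading). U b' = Unbarred k}"
    by (intro content_unbarred_entries distinct_take distinct_reverse_reading)
  then show ?thesis
    unfolding word_before_def n(2) takeWhile_neq_nth[OF distinct_reverse_reading n(1)]
    by (simp add: set_take_sorted_wrt[OF sorted_wrt_reverse_reading before_reverse_asym n(1)]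
        set_reverse_reading conj_assoc)
qed

lemma yamanouchi_word_before:
  assumes "yamanouchi d (w @ unbarred_entries U reading)" "b \<in> boxes d mu"
  shows "yamanouchi d (word_before w U b @ (if is_barred (U b) then [] else [entry_val (U b)]))"
proof -
  obtain n where n: "n < length reading" "b = reading ! n"
    using assms unfolding set_reverse_reading[symmetric] by (auto simp: in_set_conv_nth)
  have "reading = take n reading @ [b] @ drop (Suc n) reading"
    using n id_take_nth_drop[of n reading] by simp
  then have "w @ unbarred_entries U reading = (word_before w U b @ unbarred_entries U [b]) @ unbarred_entries U (drop (Suc n) reading)"
    unfolding word_before_def n(2) takeWhile_neq_nth[OF distinct_reverse_reading n(1)]
    by (metis append.assoc unbarred_entries_append)
  then show ?thesis using assms(1) yamanouchi_appendD by (metis unbarred_entries_single)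
qed

text \<open>
  Along a row, from right to left, the difference of the two indices in a factor starts out
  nonnegative, drops by at most one per column, and does not drop past an unbarred entry; so it
  vanishes at some barred entry before it becomes negative.
\<close>

lemma ex_barred_zero_factor:
  assumes yam: "yamanouchi d (w @ unbarred_entries U reading)"
    and U: "U \<in> boxes d mu \<rightarrow>\<^sub>E entries" "reverse_tableau_cond d mu (entry_val \<circ> U)"
    and b: "(r, c) \<in> boxes d mu"
    and neg: "content (word_before w U (r, c)) (entry_val (U (r, c))) + r < c"
  shows "\<exists>c'. (r, c') \<in> boxes d mu \<and> is_barred (U (r, c')) \<and>
    content (word_before w U (r, c')) (entry_val (U (r, c'))) + r = c'"
  using b neg
proof (induction c)
  case (Suc c)
  have c: "0 < c" using Suc.prems by (cases c) (auto simp: box_iff)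
  have b: "(r, c) \<in> boxes d mu"
    using c box_mono[OF Suc.prems(1), of r c] Suc.prems(1) by (auto simp: box_iff)
  define v v' where "v = entry_val (U (r, Suc c))" and "v' = entry_val (U (r, c))"
  have "v \<le> v'" using U(2) b Suc.prems(1) by (auto simp: reverse_tableau_cond_def v_def v'_def)
  moreover have "1 \<le> v" "v' \<le> d"
    using PiE_mem[OF U(1) b] PiE_mem[OF U(1) Suc.prems(1)] by (auto simp: entries_def v_def v'_def)
  moreover have "yamanouchi d (word_before w U (r, Suc c))"
    using yamanouchi_word_before[OF yam Suc.prems(1)] yamanouchi_appendD by blast
  ultimately have "content (word_before w U (r, Suc c)) v' \<le> content (word_before w U (r, Suc c)) v"
    by (intro yamanouchi_content_mono)
  moreover have "content (word_before w U (r, c)) v' + (if is_barred (U (r, c)) then 0 else 1)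
      \<le> content (word_before w U (r, Suc c)) v'"
  proof -
    let ?A = "{b' \<in> boxes d mu. before_reverse b' (r, c) \<and> U b' = Unbarred v'}"
    let ?B = "if is_barred (U (r, c)) then {} else {(r, c)}"
    have fin: "finite ?A" using finite_boxes by simp
    have "card ?A + (if is_barred (U (r, c)) then 0 else 1) = card (?A \<union> ?B)"
      using fin by (auto simp: before_reverse_def)
    also have "\<dots> \<le> card {b' \<in> boxes d mu. before_reverse b' (r, Suc c) \<and> U b' = Unbarred v'}"
    proof (rule card_mono)
      have "U (r, c) = Unbarred v'" if "\<not> is_barred (U (r, c))"
        using that by (cases "U (r, c)") (auto simp: v'_def)
      then show "?A \<union> ?B \<subseteq> {b' \<in> boxes d mu. before_reverse b' (r, Suc c) \<and> U b' = Unbarred v'}"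
        using b by (auto simp: before_reverse_def split: if_splits)
    qed (use finite_boxes in simp)
    finally show ?thesis by (simp add: content_word_before[OF b] content_word_before[OF Suc.prems(1)])
  qed
  ultimately have le: "content (word_before w U (r, c)) v' + (if is_barred (U (r, c)) then 0 else 1) + r \<le> c"
    using Suc.prems(2) unfolding v_def[symmetric] by simp
  show ?case
  proof (cases "is_barred (U (r, c)) \<and> content (word_before w U (r, c)) v' + r = c")
    case True
    then show ?thesis using b by (auto simp: v'_def)
  next
    case False
    then have "content (word_before w U (r, c)) v' + r < c" using le by (auto split: if_splits)
    then show ?thesis using Suc.IH[OF b] by (simp add: v'_def)
  qed
qed (simp add: box_iff)

text \<open>The conjugate partition.\<close>

definition height :: "nat \<Rightarrow> nat"
  where "height c = card {r \<in> {1..d}. c \<le> mu r}"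

lemma box_iff_height: "(r, c) \<in> boxes d mu \<longleftrightarrow> 1 \<le> c \<and> 1 \<le> r \<and> r \<le> height c"
proof -
  have "{r \<in> {1..d}. c \<le> mu r} = {1..height c}"
    unfolding height_def
    by (rule down_closed_eq_atLeastAtMost) (auto intro: order.trans[OF _ mu_antimono])
  then have "r \<in> {r \<in> {1..d}. c \<le> mu r} \<longleftrightarrow> r \<in> {1..height c}" by simp
  then show ?thesis by (auto simp: box_iff)
qed

lemma height_le: "height c \<le> d"
proof -
  have "height c \<le> card {1..d}" unfolding height_def by (rule card_mono) auto
  then show ?thesis by simp
qed

lemma height_antimono: "c \<le> c' \<Longrightarrow> height c' \<le> height c"
  unfolding height_def by (rule card_mono) auto

text \<open>Each column reads 1, 2, 3, ... from top to bottom; the reversal is due to rows being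
  counted from the bottom.\<close>

definition column_filling :: "nat \<times> nat \<Rightarrow> nat"
  where "column_filling = (\<lambda>(r, c). height c + 1 - r)"

definition unbarred_filling :: "nat \<times> nat \<Rightarrow> entry"
  where "unbarred_filling = restrict (\<lambda>b. Unbarred (column_filling b)) (boxes d mu)"

lemma unbarred_filling_in: "unbarred_filling \<in> boxes d mu \<rightarrow>\<^sub>E entries"
proof -
  have "column_filling b \<in> {1..d}" if "b \<in> boxes d mu" for b
    using that height_le[of "snd b"] by (cases b) (auto simp: box_iff_height column_filling_def)
  then show ?thesis by (auto simp: unbarred_filling_def entries_def)
qed

lemma unbarred_filling_cond: "reverse_tableau_cond d mu (entry_val \<circ> unbarred_filling)"
  using height_antimono
  by (auto simp: reverse_tableau_cond_def unbarred_filling_def column_filling_def box_iff_height diff_le_mono)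

lemma unbarred_entries_filling: "unbarred_entries unbarred_filling reading = map column_filling reading"
proof -
  have "map unbarred_filling reading = map (\<lambda>b. Unbarred (column_filling b)) reading"
    by (simp add: unbarred_filling_def set_reverse_reading)
  then show ?thesis by (simp add: unbarred_entries_def filter_map o_def)
qed

lemma yamanouchi_column_filling: "yamanouchi d (map column_filling reading)"
proof (rule yamanouchi_map[OF sorted_wrt_reverse_reading before_reverse_asym])
  show "inj_on (\<lambda>(r, c). (Suc r, c)) (set reading)" by (auto simp: inj_on_def)
next
  fix b k assume *: "b \<in> set reading" "1 \<le> k" "column_filling b = Suc k"
  obtain r c where b: "b = (r, c)" by (cases b)
  show "(case b of (r, c) \<Rightarrow> (Suc r, c)) \<in> set reading \<and>
      before_reverse (case b of (r, c) \<Rightarrow> (Suc r, c)) b \<and> column_filling (case b of (r, c) \<Rightarrow> (Suc r, c)) = k"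
    using * unfolding b set_reverse_reading
    by (auto simp: before_reverse_def box_iff_height column_filling_def)
qed

text \<open>The value \<open>k\<close> occurs once in each column of height at least
  \<open>k\<close>, and by conjugation there are \<open>mu k\<close> of them.\<close>

lemma content_column_filling: "content (map column_filling reading) k = mu k"
proof (cases "k \<in> {1..d}")
  case True
  have iff: "k \<le> height c \<longleftrightarrow> c \<le> mu k" if "1 \<le> c" for c
    using box_iff_height[of k c] box_iff[of k c] True that by auto
  have "bij_betw (\<lambda>c. (height c + 1 - k, c)) {1..mu k} {b \<in> boxes d mu. column_filling b = k}"
  proof (rule bij_betwI[where g = snd])
    show "(\<lambda>c. (height c + 1 - k, c)) \<in> {1..mu k} \<rightarrow> {b \<in> boxes d mu. column_filling b = k}"
    proof
      fix c assume "c \<in> {1..mu k}"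
      then show "(height c + 1 - k, c) \<in> {b \<in> boxes d mu. column_filling b = k}"
        using iff[of c] True by (auto simp: box_iff_height column_filling_def)
    qed
    show "snd \<in> {b \<in> boxes d mu. column_filling b = k} \<rightarrow> {1..mu k}"
    proof
      fix b assume b: "b \<in> {b \<in> boxes d mu. column_filling b = k}"
      obtain r c where rc: "b = (r, c)" by (cases b)
      then show "snd b \<in> {1..mu k}"
        using b iff[of c] by (auto simp: box_iff_height column_filling_def)
    qed
  qed (auto simp: box_iff_height column_filling_def)
  from bij_betw_same_card[OF this] show ?thesis
    by (simp add: content_map[OF distinct_reverse_reading] set_reverse_reading)
next
  case False
  have empty: "{b \<in> boxes d mu. column_filling b = k} = {}"
  proof -
    have "column_filling b \<in> {1..d}" if "b \<in> boxes d mu" for b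
      using that height_le[of "snd b"] by (cases b) (auto simp: box_iff_height column_filling_def)
    then show ?thesis using False by auto
  qed
  have "mu k = 0" using mu False by (auto simp: partitions_def)
  then show ?thesis
    by (simp only: content_map[OF distinct_reverse_reading] set_reverse_reading empty card.empty)
qed

text \<open>
  For the empty initial word, the \<open>c\<close>-th bottom entry \<open>v\<close> cannot be barred, since at most
  \<open>c - 1\<close> letters \<open>v\<close> precede it; hence \<open>v\<close>, and by the Yamanouchi condition every smaller letter,
  occurs unbarred in each of the first \<open>c\<close> columns.
\<close>

lemma eq_unbarred_filling:
  assumes yam: "yamanouchi d (unbarred_entries U reading)"
    and U: "U \<in> boxes d mu \<rightarrow>\<^sub>E entries" "reverse_tableau_cond d mu (entry_val \<circ> U)"
    and ge: "\<And>r c. (r, c) \<in> boxes d mu \<Longrightarrow> c \<le> content (word_before [] U (r, c)) (entry_val (U (r, c))) + r"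
    and barred: "\<And>r c. (r, c) \<in> boxes d mu \<Longrightarrow> is_barred (U (r, c)) \<Longrightarrow>
      c < content (word_before [] U (r, c)) (entry_val (U (r, c))) + r"
  shows "U = unbarred_filling"
proof (rule extensionalityI[of _ "boxes d mu"])
  show "U \<in> extensional (boxes d mu)" using U by (simp add: PiE_def)
  show "unbarred_filling \<in> extensional (boxes d mu)" by (simp add: unbarred_filling_def)
  fix b assume "b \<in> boxes d mu"
  then obtain r c where rc: "b = (r, c)" "(r, c) \<in> boxes d mu" by (cases b) auto
  have col: "entry_val (U (r', c')) < entry_val (U (r, c'))"
    if "(r, c') \<in> boxes d mu" "(r', c') \<in> boxes d mu" "r < r'" for r r' c'
    using U(2) that by (auto simp: reverse_tableau_cond_def)
  have col_inj: "r = r'"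
    if "(r, c') \<in> boxes d mu" "(r', c') \<in> boxes d mu" "entry_val (U (r, c')) = entry_val (U (r', c'))" for r r' c'
    using col[of r c' r'] col[of r' c' r] that by (cases r r' rule: linorder_cases) auto
  have inj: "inj_on snd {b' \<in> boxes d mu. Q b' \<and> U b' = Unbarred u}" for Q u
    by (rule inj_onI) (auto intro: col_inj)
  have box1: "(1, c) \<in> boxes d mu" using box_mono[OF rc(2), of 1 c] rc(2) by (auto simp: box_iff)
  define v where "v = entry_val (U (1, c))"
  have v: "1 \<le> v" "v \<le> d" using PiE_mem[OF U(1) box1] by (auto simp: entries_def v_def)
  have "card {b' \<in> boxes d mu. before_reverse b' (1, c) \<and> U b' = Unbarred v} \<le> card {1..<c}"
  proof (rule card_inj_on_le[OF inj])
    show "snd ` {b' \<in> boxes d mu. before_reverse b' (1, c) \<and> U b' = Unbarred v} \<subseteq> {1..<c}"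
      using col[OF box1] by (auto simp: before_reverse_def v_def box_iff) (metis entry_val.simps(1) less_irrefl)+
  qed simp
  then have "content (word_before [] U (1, c)) v < c"
    using content_word_before[OF box1, of "[]" U v] box1 by (auto simp: box_iff)
  with ge[OF box1] barred[OF box1] have cnt: "content (word_before [] U (1, c)) v + 1 = c"
    and unb: "\<not> is_barred (U (1, c))" by (auto simp: v_def)
  then have U1: "U (1, c) = Unbarred v" by (cases "U (1, c)") (auto simp: v_def)
  let ?w = "word_before [] U (1, c) @ [v]"
  have yw: "yamanouchi d ?w"
    using yamanouchi_word_before[of "[]" U, OF _ box1] yam U1 by simp
  have ex: "\<exists>r'. (r', c) \<in> boxes d mu \<and> U (r', c) = Unbarred u" if u: "1 \<le> u" "u \<le> v" for u
  proof -
    let ?S = "{b' \<in> boxes d mu. (before_reverse b' (1, c) \<or> b' = (1, c)) \<and> U b' = Unbarred u}"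
    have "c \<le> content ?w u"
      using yamanouchi_content_mono[OF yw u v(2)] cnt by simp
    also have "content ?w u \<le> card ?S"
    proof -
      let ?A = "{b' \<in> boxes d mu. before_reverse b' (1, c) \<and> U b' = Unbarred u}"
      have "finite ?A" using finite_boxes by simp
      moreover have not_before: "\<not> before_reverse (1, c) (1, c)" by (simp add: before_reverse_def)
      ultimately have "content ?w u = card (?A \<union> (if u = v then {(1, c)} else {}))"
        using not_before by (simp add: content_word_before[OF box1, unfolded One_nat_def])
      also have "\<dots> \<le> card ?S"
        using box1 U1 finite_boxes by (intro card_mono) auto
      finally show ?thesis .
    qed
    \<comment> \<open>With at most one \<open>u\<close> per column and \<open>c\<close> columns
      available, \<open>c\<close> occurrences leave no column out, in particular not column
      \<open>c\<close>.\<close>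
    also have "card ?S = card (snd ` ?S)" by (rule card_image[OF inj, symmetric])
    finally have "card {1..c} \<le> card (snd ` ?S)" by simp
    moreover have "snd ` ?S \<subseteq> {1..c}" by (auto simp: before_reverse_def box_iff)
    ultimately have "snd ` ?S = {1..c}" by (intro card_seteq) auto
    then have "c \<in> snd ` ?S" using box1 by (auto simp: box_iff)
    then show ?thesis by auto
  qed
  have le_v: "1 \<le> entry_val (U (r', c)) \<and> entry_val (U (r', c)) \<le> v" if "(r', c) \<in> boxes d mu" for r'
    using that col[OF box1 that] PiE_mem[OF U(1) that]
    by (cases "r' = 1") (auto simp: v_def entries_def box_iff)
  have unbarred: "U (r', c) = Unbarred (entry_val (U (r', c)))" if r': "(r', c) \<in> boxes d mu" for r'
  proof -
    obtain r'' where r'': "(r'', c) \<in> boxes d mu" "U (r'', c) = Unbarred (entry_val (U (r', c)))"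
      using ex le_v[OF r'] by blast
    then have "r'' = r'" using col_inj[OF r''(1) r'] by simp
    then show ?thesis using r'' by simp
  qed
  \<comment> \<open>The bottom entry \<open>v\<close> is the largest of its column, so the column
    consists of exactly 1 to \<open>v\<close>, and strictness fixes their order.\<close>
  have "(\<lambda>r. entry_val (U (r, c))) ` {1..height c} = {1..v}"
  proof (intro equalityI subsetI)
    fix u assume "u \<in> {1..v}"
    then obtain r' where "(r', c) \<in> boxes d mu" "U (r', c) = Unbarred u" using ex[of u] by auto
    then show "u \<in> (\<lambda>r. entry_val (U (r, c))) ` {1..height c}"
      by (auto simp: box_iff_height intro!: image_eqI[of _ _ r'])
  next
    fix u assume "u \<in> (\<lambda>r. entry_val (U (r, c))) ` {1..height c}"
    then obtain r' where r': "r' \<in> {1..height c}" "u = entry_val (U (r', c))" by blast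
    then have "(r', c) \<in> boxes d mu" using box1 by (simp add: box_iff_height)
    from le_v[OF this] show "u \<in> {1..v}" using r' by simp
  qed
  moreover have "inj_on (\<lambda>r. entry_val (U (r, c))) {1..height c}"
    using box1 by (auto simp: inj_on_def box_iff_height intro: col_inj)
  ultimately have hv: "height c = v" by (metis card_atLeastAtMost card_image diff_Suc_1)
  have "entry_val (U (r, c)) = height c + 1 - r"
  proof (rule strict_antimono_eq_reverse)
    show "entry_val (U (j, c)) < entry_val (U (i, c))" if "1 \<le> i" "i < j" "j \<le> height c" for i j
      using that box1 by (intro col) (auto simp: box_iff_height)
    show "1 \<le> entry_val (U (i, c)) \<and> entry_val (U (i, c)) \<le> height c" if "1 \<le> i" "i \<le> height c" for i
      using that box1 le_v[of i] unfolding hv[symmetric] by (auto simp: box_iff_height)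
  qed (use rc in \<open>auto simp: box_iff_height\<close>)
  then show "U b = unbarred_filling b"
    using unbarred[OF rc(2)] rc by (simp add: unbarred_filling_def column_filling_def)
qed

lemma bar_factor_eq: "bar_factor w U (r, c) =
    y (compl_index d (entry_val (U (r, c))) + content (word_before w U (r, c)) (entry_val (U (r, c))))
    - y (compl_index d (entry_val (U (r, c))) + c - r)"
  by (simp add: bar_factor_def word_before_def Let_def)

lemma bar_factor_eq_0:
  assumes "content (word_before w U (r, c)) (entry_val (U (r, c))) + r = c"
  shows "bar_factor w U (r, c) = 0"
proof -
  have "compl_index d (entry_val (U (r, c))) + c - r =
      compl_index d (entry_val (U (r, c))) + content (word_before w U (r, c)) (entry_val (U (r, c)))"
    using assms by simp
  then show ?thesis by (simp add: bar_factor_eq)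
qed

text \<open>The expansion for the empty word, whose alternant is of Vandermonde type. If no barred
  entry of a tableau had equal indices, \<open>ex_barred_zero_factor\<close> would exclude negative
  differences everywhere, and \<open>eq_unbarred_filling\<close> would identify the tableau.\<close>

lemma bialternant_formula:
  "antisymmetrize d (monom (\<lambda>i. d - i)) x * schur x = antisymmetrize d (monom (\<lambda>i. d - i + mu i)) x"
proof -
  define Y where "Y = {U. U \<in> boxes d mu \<rightarrow>\<^sub>E entries \<and> reverse_tableau_cond d mu (entry_val \<circ> U) \<and>
        yamanouchi d ([] @ unbarred_entries U reading)}"
  define F where "F U = (\<Prod>b | b \<in> boxes d mu \<and> is_barred (U b). bar_factor [] U b) *
      antisymmetrize d (monom (exponent ([] @ unbarred_entries U reading))) x" for U
  have fin: "finite Y" unfolding Y_def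
    by (rule finite_subset[of _ "boxes d mu \<rightarrow>\<^sub>E entries"]) (auto intro: finite_PiE finite_boxes simp: entries_def)
  have in_Y: "unbarred_filling \<in> Y"
    using unbarred_filling_in unbarred_filling_cond yamanouchi_column_filling
    by (simp add: Y_def unbarred_entries_filling)
  have zero: "F U = 0" if U: "U \<in> Y - {unbarred_filling}" for U
  proof -
    have U': "U \<in> boxes d mu \<rightarrow>\<^sub>E entries" "reverse_tableau_cond d mu (entry_val \<circ> U)"
      "yamanouchi d ([] @ unbarred_entries U reading)" using U by (auto simp: Y_def)
    have "\<exists>r c. (r, c) \<in> boxes d mu \<and> is_barred (U (r, c)) \<and>
        content (word_before [] U (r, c)) (entry_val (U (r, c))) + r = c"
    proof (rule ccontr)
      assume no: "\<not> ?thesis"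
      then have ge: "c \<le> content (word_before [] U (r, c)) (entry_val (U (r, c))) + r"
        if "(r, c) \<in> boxes d mu" for r c
        using ex_barred_zero_factor[OF U'(3,1,2) that] by (meson not_le)
      moreover have "c < content (word_before [] U (r, c)) (entry_val (U (r, c))) + r"
        if "(r, c) \<in> boxes d mu" "is_barred (U (r, c))" for r c
        using ge[OF that(1)] no that by (metis le_neq_implies_less)
      ultimately have "U = unbarred_filling" using U' by (intro eq_unbarred_filling) auto
      then show False using U by simp
    qed
    then have "\<exists>b\<in>{b. b \<in> boxes d mu \<and> is_barred (U b)}. bar_factor [] U b = 0"
      using bar_factor_eq_0 by blast
    then have "(\<Prod>b | b \<in> boxes d mu \<and> is_barred (U b). bar_factor [] U b) = 0"
      using finite_boxes by (intro prod_zero) simp_all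
    then show ?thesis by (simp add: F_def)
  qed
  have "antisymmetrize d (monom (\<lambda>i. d - i)) x * schur x = (\<Sum>U\<in>Y. F U)"
    using bar_expansion[of "[]" x] by (simp add: Y_def F_def exponent_def[abs_def])
  also have "\<dots> = F unbarred_filling + (\<Sum>U\<in>Y - {unbarred_filling}. F U)"
    using fin in_Y by (rule sum.remove)
  also have "\<dots> = F unbarred_filling" using zero by simp
  also have "\<dots> = antisymmetrize d (monom (\<lambda>i. d - i + mu i)) x"
  proof -
    have empty: "{b. b \<in> boxes d mu \<and> is_barred (unbarred_filling b)} = {}"
      by (auto simp: unbarred_filling_def)
    show ?thesis
      unfolding F_def empty
      by (simp add: unbarred_entries_filling exponent_def[abs_def] content_column_filling)
  qed
  finally show ?thesis .
qed

end

subsection \<open>Linear independence of the alternants\<close>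

lemma Const_0 [simp]: "Const 0 = 0"
  by (simp add: Const_def)

lemma Const_1 [simp]: "Const 1 = 1"
  by (simp add: Const_def)

lemma Const_add: "Const (a + b) = Const a + Const b"
  by (simp add: Const_def single_add)

lemma Const_diff: "Const (a - b) = Const a - Const b"
  by (simp add: Const_def single_diff)

lemma Const_mult: "Const (a * b) = Const a * Const b"
  by (simp add: Const_def mult_single)

lemma Const_sum: "Const (sum f S) = (\<Sum>i\<in>S. Const (f i))"
  by (induction S rule: infinite_finite_induct) (simp_all add: Const_add)

lemma Const_prod: "Const (prod f S) = (\<Prod>i\<in>S. Const (f i))"
  by (induction S rule: infinite_finite_induct) (simp_all add: Const_mult)

lemma Var_inject: "(Var i :: 'a::{comm_ring_1} mpol) = Var j \<longleftrightarrow> i = j"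
proof
  assume "(Var i :: 'a mpol) = Var j"
  then have "Poly_Mapping.lookup (Var i :: 'a mpol) (Poly_Mapping.single i 1) = Poly_Mapping.lookup (Var j) (Poly_Mapping.single i 1)"
    by simp
  then have "Poly_Mapping.single i (1::nat) = Poly_Mapping.single j 1"
    by (simp add: Var_def lookup_single when_def split: if_splits)
  then have "Poly_Mapping.lookup (Poly_Mapping.single i (1::nat)) i = Poly_Mapping.lookup (Poly_Mapping.single j 1) i" by simp
  then show "i = j" by (simp add: lookup_single when_def split: if_splits)
qed simp

definition monomial_value :: "(nat \<Rightarrow> 'a) \<Rightarrow> (nat \<Rightarrow>\<^sub>0 nat) \<Rightarrow> 'a::comm_ring_1"
  where "monomial_value g m = (\<Prod>i\<in>Poly_Mapping.keys m. g i ^ Poly_Mapping.lookup m i)"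

text \<open>Only the outer variables are substituted: on \<open>xypol\<close> each \<open>x\<close>
  becomes a polynomial in the \<open>y\<close>, and the coefficients stay as they are.\<close>

definition eval :: "(nat \<Rightarrow> 'a) \<Rightarrow> 'a mpol \<Rightarrow> 'a::comm_ring_1"
  where "eval g p = (\<Sum>m\<in>Poly_Mapping.keys p. Poly_Mapping.lookup p m * monomial_value g m)"

lemma monomial_value_superset:
  "finite S \<Longrightarrow> Poly_Mapping.keys m \<subseteq> S \<Longrightarrow> monomial_value g m = (\<Prod>i\<in>S. g i ^ Poly_Mapping.lookup m i)"
  unfolding monomial_value_def by (rule prod.mono_neutral_left) (auto simp: in_keys_iff)

lemma monomial_value_add: "monomial_value g (m + n) = monomial_value g m * monomial_value g n"
proof -
  let ?S = "Poly_Mapping.keys m \<union> Poly_Mapping.keys n"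
  have "monomial_value g (m + n) = (\<Prod>i\<in>?S. g i ^ Poly_Mapping.lookup (m + n) i)"
    using keys_add[of m n] by (intro monomial_value_superset) auto
  then show ?thesis
    by (simp add: monomial_value_superset[of ?S] lookup_add power_add prod.distrib)
qed

lemma eval_superset:
  "finite S \<Longrightarrow> Poly_Mapping.keys p \<subseteq> S \<Longrightarrow> eval g p = (\<Sum>m\<in>S. Poly_Mapping.lookup p m * monomial_value g m)"
  unfolding eval_def by (rule sum.mono_neutral_left) (auto simp: in_keys_iff)

lemma eval_add: "eval g (p + q) = eval g p + eval g q"
proof -
  let ?S = "Poly_Mapping.keys p \<union> Poly_Mapping.keys q"
  have "eval g (p + q) = (\<Sum>m\<in>?S. Poly_Mapping.lookup (p + q) m * monomial_value g m)"
    using keys_add[of p q] by (intro eval_superset) auto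
  then show ?thesis
    by (simp add: eval_superset[of ?S] lookup_add distrib_right sum.distrib)
qed

lemma eval_0 [simp]: "eval g 0 = 0"
  by (simp add: eval_def)

lemma eval_uminus: "eval g (- p) = - eval g p"
  using eval_add[of g p "- p"] by (simp add: eq_neg_iff_add_eq_0 add.commute)

lemma eval_diff: "eval g (p - q) = eval g p - eval g q"
  using eval_add[of g p "- q"] by (simp add: eval_uminus)

lemma eval_sum: "eval g (sum f S) = (\<Sum>i\<in>S. eval g (f i))"
  by (induction S rule: infinite_finite_induct) (simp_all add: eval_add)

lemma eval_single: "eval g (Poly_Mapping.single m c) = c * monomial_value g m"
  by (cases "c = 0") (simp_all add: eval_def)

lemma poly_mapping_sum_single: "p = (\<Sum>m\<in>Poly_Mapping.keys p. Poly_Mapping.single m (Poly_Mapping.lookup p m))"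
proof (rule poly_mapping_eqI)
  fix k
  have "(\<Sum>m\<in>Poly_Mapping.keys p. Poly_Mapping.lookup (Poly_Mapping.single m (Poly_Mapping.lookup p m)) k) = (\<Sum>m\<in>Poly_Mapping.keys p. if m = k then Poly_Mapping.lookup p k else 0)"
    by (rule sum.cong) (auto simp: lookup_single when_def)
  then show "Poly_Mapping.lookup p k = Poly_Mapping.lookup (\<Sum>m\<in>Poly_Mapping.keys p. Poly_Mapping.single m (Poly_Mapping.lookup p m)) k"
    by (simp add: lookup_sum in_keys_iff)
qed

lemma eval_mult: "eval g (p * q) = eval g p * eval g q"
proof -
  have "p * q = (\<Sum>m\<in>Poly_Mapping.keys p. Poly_Mapping.single m (Poly_Mapping.lookup p m)) *
      (\<Sum>n\<in>Poly_Mapping.keys q. Poly_Mapping.single n (Poly_Mapping.lookup q n))"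
    by (rule arg_cong2[where f = "(*)", OF poly_mapping_sum_single poly_mapping_sum_single])
  also have "\<dots> = (\<Sum>m\<in>Poly_Mapping.keys p. \<Sum>n\<in>Poly_Mapping.keys q.
      Poly_Mapping.single (m + n) (Poly_Mapping.lookup p m * Poly_Mapping.lookup q n))"
    by (simp only: sum_product mult_single)
  finally have expand: "p * q = \<dots>" .
  show ?thesis
    unfolding expand
    by (simp only: eval_sum eval_single monomial_value_add eval_def[of g p] eval_def[of g q] sum_product mult_ac)
qed

lemma eval_Const [simp]: "eval g (Const c) = c"
  by (simp add: Const_def eval_single monomial_value_def)

lemma eval_1 [simp]: "eval g 1 = 1"
  using eval_Const[of g 1] by simp

lemma eval_Var [simp]: "eval g (Var i) = g i"
  by (simp add: Var_def eval_single monomial_value_def)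

lemma eval_prod: "eval g (prod f S) = (\<Prod>i\<in>S. eval g (f i))"
  by (induction S rule: infinite_finite_induct) (simp_all add: eval_mult)

lemma eval_of_int_sign: "eval g (of_int (sign p)) = of_int (sign p)"
  by (simp add: sign_def eval_uminus)

section \<open>Alternants as polynomials\<close>

definition y_var :: "nat \<Rightarrow> xypol"
  where "y_var i = Const (Var i)"

definition alternant_of :: "nat \<Rightarrow> (nat \<Rightarrow> nat) \<Rightarrow> xypol"
  where "alternant_of d nu = antisymmetrize d (shape.monom d y_var (\<lambda>i. d - i + nu i)) Var"

lemma eval_alternant_of:
  assumes "nu \<in> partitions d"
  shows "eval g (alternant_of d nu) =
    (\<Sum>p | p permutes {1..d}. of_int (sign p) * (\<Prod>i=1..d. \<Prod>j=1..d - i + nu i. g (p i) - Var j))"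
proof -
  interpret shape d nu y_var by unfold_locales (rule assms)
  show ?thesis
    by (simp add: alternant_of_def antisymmetrize_def monom_def falling_def y_var_def
        eval_sum eval_mult eval_prod eval_diff eval_of_int_sign)
qed

lemma permutes_strict_mono_eq_id:
  fixes d :: nat
  assumes p: "p permutes {1..d}" and less: "\<And>i j. 1 \<le> i \<Longrightarrow> i < j \<Longrightarrow> j \<le> d \<Longrightarrow> p i < p j"
  shows "p = id"
proof
  fix i
  have range: "1 \<le> p j \<and> p j \<le> d" if "1 \<le> j" "j \<le> d" for j
    using permutes_in_image[OF p, of j] that by simp
  show "p i = id i"
  proof (cases "i \<in> {1..d}")
    case True
    have "d + 1 - p i = d + 1 - i"
    proof (rule strict_antimono_eq_reverse[where f = "\<lambda>i. d + 1 - p i"])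
      show "d + 1 - p j < d + 1 - p i" if "1 \<le> i" "i < j" "j \<le> d" for i j
        using less[OF that] range[of j] that by simp
      show "1 \<le> d + 1 - p i \<and> d + 1 - p i \<le> d" if "1 \<le> i" "i \<le> d" for i
        using range[OF that] by auto
    qed (use True in auto)
    moreover have "p i \<le> d" "i \<le> d" using range[of i] True by auto
    ultimately show ?thesis by simp
  next
    case False
    then show ?thesis using p by (simp add: permutes_not_in)
  qed
qed

text \<open>
  Evaluating at \<open>x\<^sub>i = y\<close> of index \<open>\<kappa>\<^sub>i + d - i + 1\<close>, with \<open>\<kappa>\<close> of minimal size among the partitions
  involved, kills every alternant except the one of \<open>\<kappa>\<close>.
\<close>

lemma alternants_independent:
  assumes K: "finite K" "K \<subseteq> partitions d" and sum: "(\<Sum>nu\<in>K. Const (e nu) * alternant_of d nu) = 0"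
    and "nu \<in> K"
  shows "e nu = (0 :: ypol)"
proof (rule ccontr)
  assume "e nu \<noteq> 0"
  define K' where "K' = {nu \<in> K. e nu \<noteq> 0}"
  have "nu \<in> K'" using \<open>nu \<in> K\<close> \<open>e nu \<noteq> 0\<close> by (simp add: K'_def)
  then obtain kappa where kappa: "kappa \<in> K'"
    and min: "\<And>nu. nu \<in> K' \<Longrightarrow> (\<Sum>i=1..d. kappa i) \<le> (\<Sum>i=1..d. nu i)"
    using ex_has_least_nat[of "\<lambda>nu. nu \<in> K'" nu "\<lambda>nu. \<Sum>i=1..d. nu i"] by blast
  have part: "nu \<in> partitions d" if "nu \<in> K'" for nu using that K by (auto simp: K'_def)
  define s where "s nu i = d - i + nu i" for nu and i :: nat
  have s_less: "s nu j < s nu i" if "nu \<in> K'" "1 \<le> i" "i < j" "j \<le> d" for nu i j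
  proof -
    have "nu j \<le> nu i" using part[OF that(1)] that by (auto simp: partitions_def)
    then show ?thesis using that by (simp add: s_def)
  qed
  define g :: "nat \<Rightarrow> ypol" where "g i = Var (Suc (s kappa i))" for i
  define P where "P nu p = (\<Prod>i=1..d. \<Prod>j=1..s nu i. g (p i) - Var j)" for nu p
  have P_eq_0: "nu = kappa \<and> p = id" if nu: "nu \<in> K'" and p: "p permutes {1..d}" and nz: "P nu p \<noteq> 0" for nu p
  proof -
    \<comment> \<open>Otherwise the value substituted for the variable numbered \<open>p i\<close>
      is one of the zeros of the falling product at position \<open>i\<close>.\<close>
    have le: "s nu i \<le> s kappa (p i)" if "i \<in> {1..d}" for i
    proof (rule ccontr)
      assume "\<not> ?thesis"
      then have "Suc (s kappa (p i)) \<in> {1..s nu i}" by simp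
      then have "(\<Prod>j=1..s nu i. g (p i) - Var j) = 0" by (intro prod_zero) (auto simp: g_def)
      then have "P nu p = 0" unfolding P_def using that by (intro prod_zero) auto
      with nz show False by simp
    qed
    have perm: "(\<Sum>i=1..d. s kappa (p i)) = (\<Sum>i=1..d. s kappa i)"
      using sum.permute[OF p, of "s kappa"] by (simp add: o_def)
    have "(\<Sum>i=1..d. s nu i) \<le> (\<Sum>i=1..d. s kappa (p i))" by (rule sum_mono) (rule le)
    \<comment> \<open>Minimality of \<open>kappa\<close> bounds the sums in the opposite direction,
      so all the termwise inequalities are equalities.\<close>
    moreover have "(\<Sum>i=1..d. s kappa i) \<le> (\<Sum>i=1..d. s nu i)"
      using min[OF nu] unfolding s_def sum.distrib by (rule add_left_mono)
    ultimately have "(\<Sum>i=1..d. s nu i) = (\<Sum>i=1..d. s kappa (p i))" using perm by simp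
    from sum_mono_inv[OF this le] have eq: "s nu i = s kappa (p i)" if "i \<in> {1..d}" for i
      using that by simp
    \<comment> \<open>Both exponent sequences strictly decrease, so \<open>p\<close> has no
      inversion.\<close>
    have "p = id"
    proof (rule permutes_strict_mono_eq_id[OF p], rule ccontr)
      fix i j assume ij: "1 \<le> i" "i < j" "j \<le> d" and "\<not> p i < p j"
      moreover have "p i \<noteq> p j" using permutes_inj[OF p] ij by (auto dest: injD)
      ultimately have "p j < p i" by simp
      moreover have "p i \<in> {1..d}" "p j \<in> {1..d}"
        using permutes_in_image[OF p] ij by auto
      ultimately have "s kappa (p i) < s kappa (p j)" using s_less[OF kappa] by simp
      then show False using eq[of i] eq[of j] s_less[OF nu ij] ij by simp
    qed
    moreover have "nu i = kappa i" for i
    proof (cases "i \<in> {1..d}")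
      case True
      from eq[OF True] \<open>p = id\<close> have "d - i + nu i = d - i + kappa i" by (simp only: s_def id_apply)
      then show ?thesis by (simp only: add_left_cancel)
    next
      case False
      then show ?thesis using part[OF nu] part[OF kappa] by (auto simp: partitions_def)
    qed
    ultimately show ?thesis by auto
  qed
  \<comment> \<open>Every factor is a difference of two distinct \<open>y\<close>, since
    \<open>j\<close> stays below \<open>Suc (s kappa i)\<close>.\<close>
  have "P kappa id \<noteq> 0"
    by (auto simp: P_def g_def Var_inject)
  have alt: "eval g (alternant_of d nu) = (if nu = kappa then P kappa id else 0)" if nu: "nu \<in> K'" for nu
  proof -
    have "eval g (alternant_of d nu) = (\<Sum>p | p permutes {1..d}. of_int (sign p) * P nu p)"
      unfolding eval_alternant_of[OF part[OF nu]] P_def s_def ..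
    also have "\<dots> = (\<Sum>p\<in>{id}. of_int (sign p) * P nu p)"
      using P_eq_0[OF nu] by (intro sum.mono_neutral_right) (auto simp: finite_permutations permutes_id)
    also have "\<dots> = (if nu = kappa then P kappa id else 0)"
      using P_eq_0[OF nu, of id] by (auto simp: permutes_id)
    finally show ?thesis .
  qed
  have "0 = (\<Sum>nu\<in>K. e nu * eval g (alternant_of d nu))"
    using arg_cong[OF sum, of "eval g"] by (simp add: eval_sum eval_mult)
  also have "\<dots> = (\<Sum>nu\<in>K'. e nu * eval g (alternant_of d nu))"
    using K by (intro sum.mono_neutral_right) (auto simp: K'_def)
  also have "\<dots> = (\<Sum>nu\<in>K'. if nu = kappa then e kappa * P kappa id else 0)"
    by (intro sum.cong refl) (auto simp: alt)
  also have "\<dots> = e kappa * P kappa id"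
    using kappa K by (simp add: K'_def)
  finally show False using \<open>P kappa id \<noteq> 0\<close> kappa by (simp add: K'_def)
qed

text \<open>Makes this alternant cancellable in the domain of polynomials.\<close>

lemma alternant_of_0_neq_0: "alternant_of d (\<lambda>_. 0) \<noteq> 0"
proof
  assume "alternant_of d (\<lambda>_. 0) = 0"
  then have "(1 :: ypol) = 0"
    by (intro alternants_independent[of "{\<lambda>_. 0}" d "\<lambda>_. 1"]) (auto simp: partitions_def)
  then show False by simp
qed

lemma alternant_of_factorial_schur:
  assumes "nu \<in> partitions d"
  shows "alternant_of d (\<lambda>_. 0) * factorial_schur d nu = alternant_of d nu"
proof -
  interpret shape d nu y_var by unfold_locales (rule assms)
  have "factorial_schur d nu = schur Var"
    by (simp add: factorial_schur_def schur_def factor_def y_var_def case_prod_unfold)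
  then show ?thesis using bialternant_formula[of Var] by (simp add: alternant_of_def)
qed

text \<open>Multiplication by the alternant of the empty partition turns factorial Schur functions
  into alternants. Cancelling it gives existence of the expansion, independence of the alternants
  gives uniqueness, and so the definite description denotes \<open>c\<close>.\<close>

lemma structure_const_eqI:
  assumes fin: "finite {nu. c nu \<noteq> 0}" and part: "{nu. c nu \<noteq> 0} \<subseteq> partitions d"
    and la: "la \<in> partitions d"
    and eq: "alternant_of d la * factorial_schur d mu = (\<Sum>nu | c nu \<noteq> 0. Const (c nu) * alternant_of d nu)"
  shows "structure_const d la mu = c"
proof -
  let ?a = "alternant_of d (\<lambda>_. 0)"
  define c0 where "c0 = Abs_poly_mapping c"
  have lookup_c0: "Poly_Mapping.lookup c0 = c" using fin by (simp add: c0_def Abs_poly_mapping_inverse)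
  have keys_c0: "Poly_Mapping.keys c0 = {nu. c nu \<noteq> 0}" by (auto simp: in_keys_iff lookup_c0)
  have mult: "?a * (\<Sum>nu\<in>Poly_Mapping.keys f. Const (Poly_Mapping.lookup f nu) * factorial_schur d nu) =
      (\<Sum>nu\<in>Poly_Mapping.keys f. Const (Poly_Mapping.lookup f nu) * alternant_of d nu)"
    if "Poly_Mapping.keys f \<subseteq> partitions d" for f
    unfolding sum_distrib_left
  proof (rule sum.cong[OF refl])
    fix nu assume "nu \<in> Poly_Mapping.keys f"
    then have "?a * factorial_schur d nu = alternant_of d nu"
      using that by (intro alternant_of_factorial_schur) auto
    then show "?a * (Const (Poly_Mapping.lookup f nu) * factorial_schur d nu) =
        Const (Poly_Mapping.lookup f nu) * alternant_of d nu"
      by (simp only: mult.left_commute)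
  qed
  have a_eq: "?a * (factorial_schur d la * factorial_schur d mu) =
      (\<Sum>nu\<in>Poly_Mapping.keys c0. Const (Poly_Mapping.lookup c0 nu) * alternant_of d nu)"
    using eq alternant_of_factorial_schur[OF la] by (simp add: keys_c0 lookup_c0 mult.assoc[symmetric])
  have "(THE f. Poly_Mapping.keys f \<subseteq> partitions d \<and> factorial_schur d la * factorial_schur d mu =
      (\<Sum>nu\<in>Poly_Mapping.keys f. Const (Poly_Mapping.lookup f nu) * factorial_schur d nu)) = c0"
  proof (rule the_equality)
    have c0: "Poly_Mapping.keys c0 \<subseteq> partitions d" using part by (simp add: keys_c0)
    from trans[OF a_eq mult[OF c0, symmetric]]
    have "factorial_schur d la * factorial_schur d mu =
        (\<Sum>nu\<in>Poly_Mapping.keys c0. Const (Poly_Mapping.lookup c0 nu) * factorial_schur d nu)"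
      by (rule mult_left_cancel[OF alternant_of_0_neq_0, THEN iffD1])
    with c0 show "Poly_Mapping.keys c0 \<subseteq> partitions d \<and> factorial_schur d la * factorial_schur d mu =
        (\<Sum>nu\<in>Poly_Mapping.keys c0. Const (Poly_Mapping.lookup c0 nu) * factorial_schur d nu)" ..
    fix f assume f: "Poly_Mapping.keys f \<subseteq> partitions d \<and> factorial_schur d la * factorial_schur d mu =
      (\<Sum>nu\<in>Poly_Mapping.keys f. Const (Poly_Mapping.lookup f nu) * factorial_schur d nu)"
    let ?K = "Poly_Mapping.keys f \<union> Poly_Mapping.keys c0"
    have ext: "(\<Sum>nu\<in>Poly_Mapping.keys h. Const (Poly_Mapping.lookup h nu) * alternant_of d nu) =
        (\<Sum>nu\<in>?K. Const (Poly_Mapping.lookup h nu) * alternant_of d nu)" if "Poly_Mapping.keys h \<subseteq> ?K" for h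
      using that by (intro sum.mono_neutral_left) (auto simp: in_keys_iff)
    have "(\<Sum>nu\<in>Poly_Mapping.keys f. Const (Poly_Mapping.lookup f nu) * alternant_of d nu) =
        (\<Sum>nu\<in>Poly_Mapping.keys c0. Const (Poly_Mapping.lookup c0 nu) * alternant_of d nu)"
      by (rule trans[OF trans[OF mult[symmetric] arg_cong[of _ _ "(*) ?a"]] a_eq]) (use f in auto)
    then have "(\<Sum>nu\<in>?K. Const (Poly_Mapping.lookup f nu) * alternant_of d nu) =
        (\<Sum>nu\<in>?K. Const (Poly_Mapping.lookup c0 nu) * alternant_of d nu)"
      by (simp add: ext)
    then have "(\<Sum>nu\<in>?K. Const (Poly_Mapping.lookup f nu - Poly_Mapping.lookup c0 nu) * alternant_of d nu) = 0"
      by (simp add: Const_diff left_diff_distrib sum_subtractf)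
    then have diff: "Poly_Mapping.lookup f nu - Poly_Mapping.lookup c0 nu = 0" if "nu \<in> ?K" for nu
      using that f c0 by (intro alternants_independent[of ?K d "\<lambda>nu. Poly_Mapping.lookup f nu - Poly_Mapping.lookup c0 nu"]) auto
    show "f = c0"
    proof (rule poly_mapping_eqI)
      fix nu show "Poly_Mapping.lookup f nu = Poly_Mapping.lookup c0 nu"
        using diff[of nu] by (cases "nu \<in> ?K") (auto simp: in_keys_iff)
    qed
  qed
  then show ?thesis unfolding structure_const_def using lookup_c0 by simp
qed

theorem corollary2p8:
  fixes d :: nat and la mu nu :: "nat \<Rightarrow> nat"
  assumes "d > 0"
    and "la \<in> partitions d" and "mu \<in> partitions d" and "nu \<in> partitions d"
  shows "structure_const d la mu nu = (\<Sum>L\<in>LR_pos d la mu nu. weight d la mu L)"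
proof -
  interpret L: shape d la y_var by unfold_locales (rule assms)
  interpret M: shape d mu y_var by unfold_locales (rule assms)
  define T0 where "T0 = L.superstandard"
  define w0 where "w0 = map T0 (young_reading d la)"
  define word where "word U = w0 @ unbarred_entries U (reverse_reading d mu)" for U
  define Y where "Y = {U. U \<in> boxes d mu \<rightarrow>\<^sub>E M.entries \<and> reverse_tableau_cond d mu (entry_val \<circ> U) \<and>
        yamanouchi d (word U)}"
  have w0: "yamanouchi d w0" "\<And>k. content w0 k = la k"
    using L.yamanouchi_superstandard L.content_superstandard by (simp_all add: w0_def T0_def)
  have finY: "finite Y" unfolding Y_def
    by (rule finite_subset[of _ "boxes d mu \<rightarrow>\<^sub>E M.entries"])
      (auto intro: finite_PiE M.finite_boxes simp: M.entries_def)
  \<comment> \<open>The word of the first shape is a prefix of a Yamanouchi word, so the first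
    component is always \<open>T0\<close>.\<close>
  have LR: "LR d la mu nu = Pair T0 ` {U \<in> Y. content (word U) = nu}" for nu
  proof (intro equalityI subsetI)
    fix L assume L: "L \<in> LR d la mu nu"
    obtain T U where TU: "L = (T, U)" by (cases L)
    have T: "T \<in> boxes d la \<rightarrow>\<^sub>E {1..d}" "tableau_cond d la T"
      and yam: "yamanouchi d (map T (young_reading d la) @ unbarred_entries U (reverse_reading d mu))"
      using L by (auto simp: TU LR_def skew_barred_tableaux_def unbarred_word_def)
    have "T = T0"
      unfolding T0_def using T yamanouchi_appendD[OF yam] by (rule L.yamanouchi_imp_superstandard)
    then show "L \<in> Pair T0 ` {U \<in> Y. content (word U) = nu}"
      using L by (auto simp: TU LR_def skew_barred_tableaux_def unbarred_word_def Y_def word_def w0_def M.entries_def)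
  next
    fix L assume "L \<in> Pair T0 ` {U \<in> Y. content (word U) = nu}"
    then show "L \<in> LR d la mu nu"
      using L.superstandard_tableau
      by (auto simp: LR_def skew_barred_tableaux_def unbarred_word_def Y_def word_def w0_def M.entries_def T0_def)
  qed
  have before: "unbarred_word_before d la mu (T0, U) b = M.word_before w0 U b" for U b
    by (simp add: unbarred_word_before_def M.word_before_def w0_def)
  have factor: "weight_factor d la mu (T0, U) (r, c) =
      Var (compl_index d (entry_val (U (r, c))) + content (M.word_before w0 U (r, c)) (entry_val (U (r, c))))
      - Var (compl_index d (entry_val (U (r, c))) + c - r)" for U r c
    by (simp add: weight_factor_def before Let_def)
  have Const_factor: "Const (weight_factor d la mu (T0, U) b) = M.bar_factor w0 U b" for U b
    by (cases b) (simp add: factor M.bar_factor_eq Const_diff y_var_def)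
  have Const_weight: "Const (weight d la mu (T0, U)) =
      (\<Prod>b | b \<in> boxes d mu \<and> is_barred (U b). M.bar_factor w0 U b)" for U
    by (simp add: weight_def barred_boxes_def Const_prod Const_factor)
  have finLR: "finite (LR d la mu nu)" for nu unfolding LR using finY by simp
  have pos: "(\<Sum>L\<in>LR_pos d la mu nu. weight d la mu L) = (\<Sum>L\<in>LR d la mu nu. weight d la mu L)" for nu
  proof (rule sum.mono_neutral_left[OF finLR])
    show "LR_pos d la mu nu \<subseteq> LR d la mu nu" by (auto simp: LR_pos_def)
    show "\<forall>L\<in>LR d la mu nu - LR_pos d la mu nu. weight d la mu L = 0"
    proof
      fix L assume L: "L \<in> LR d la mu nu - LR_pos d la mu nu"
      then obtain U where U: "L = (T0, U)" "U \<in> Y" by (auto simp: LR)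
      have "\<not> weight_pos d la mu (T0, U)" using L U by (simp add: LR_pos_def)
      then obtain r c where rc: "(r, c) \<in> boxes d mu" "is_barred (U (r, c))"
        and notpos: "\<And>i j. j < i \<Longrightarrow> weight_factor d la mu (T0, U) (r, c) \<noteq> Var i - Var j"
        by (auto simp: weight_pos_def barred_boxes_def)
      let ?n = "\<lambda>c. content (M.word_before w0 U (r, c)) (entry_val (U (r, c)))"
      have "U (r, c) \<in> M.entries"
        using U(2) rc(1) PiE_mem[of U "boxes d mu" "\<lambda>_. M.entries"] by (simp add: Y_def)
      \<comment> \<open>Guards against truncation: even if the subtraction of \<open>r\<close>
        stopped at 0, the other index would still be larger.\<close>
      then have "1 \<le> compl_index d (entry_val (U (r, c)))"
        by (auto simp: M.entries_def compl_index_def)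
      moreover have "\<not> compl_index d (entry_val (U (r, c))) + c - r < compl_index d (entry_val (U (r, c))) + ?n c"
        using notpos factor by blast
      ultimately have le: "?n c + r \<le> c" by simp
      have "\<exists>c'. (r, c') \<in> boxes d mu \<and> is_barred (U (r, c')) \<and> ?n c' + r = c'"
      proof (cases "?n c + r = c")
        case True
        then show ?thesis using rc by blast
      next
        case False
        then show ?thesis
          using U(2) rc le by (intro M.ex_barred_zero_factor) (auto simp: Y_def word_def)
      qed
      then have "\<exists>b\<in>{b. b \<in> boxes d mu \<and> is_barred (U b)}. M.bar_factor w0 U b = 0"
        using M.bar_factor_eq_0 by blast
      then have "(\<Prod>b | b \<in> boxes d mu \<and> is_barred (U b). M.bar_factor w0 U b) = 0"
        using M.finite_boxes by (intro prod_zero) simp_all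
      then have "Const (weight d la mu L) = Const 0" by (simp add: U Const_weight)
      \<comment> \<open>Evaluation at any point is a left inverse of \<open>Const\<close>.\<close>
      from arg_cong[OF this, of "eval undefined"] show "weight d la mu L = 0" by simp
    qed
  qed
  define c where "c nu = (\<Sum>L\<in>LR_pos d la mu nu. weight d la mu L)" for nu
  have c: "c nu = (\<Sum>U | U \<in> Y \<and> content (word U) = nu. weight d la mu (T0, U))" for nu
    unfolding c_def pos LR by (subst sum.reindex) (auto simp: inj_on_def)
  let ?V = "(\<lambda>U. content (word U)) ` Y"
  have V: "{nu. c nu \<noteq> 0} \<subseteq> ?V"
  proof
    fix nu assume "nu \<in> {nu. c nu \<noteq> 0}"
    then have "{U. U \<in> Y \<and> content (word U) = nu} \<noteq> {}" unfolding c by force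
    then show "nu \<in> ?V" by blast
  qed
  have part: "content (word U) \<in> partitions d" if U: "U \<in> Y" for U
  proof -
    have "k \<in> {1..d}" if "content (word U) k \<noteq> 0" for k
    proof (rule ccontr)
      assume k: "k \<notin> {1..d}"
      then have "la k = 0" using assms(2) by (auto simp: partitions_def)
      moreover have "content (unbarred_entries U (reverse_reading d mu)) k = 0"
      proof -
        have "{b \<in> boxes d mu. U b = Unbarred k} = {}"
        proof -
          have "U b \<noteq> Unbarred k" if "b \<in> boxes d mu" for b
            using U that k PiE_mem[of U "boxes d mu" "\<lambda>_. M.entries" b] by (auto simp: Y_def M.entries_def)
          then show ?thesis by blast
        qed
        then show ?thesis
          by (simp only: content_unbarred_entries[OF distinct_reverse_reading] M.set_reverse_reading card.empty)
      qed
      ultimately show False using that by (simp add: word_def w0)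
    qed
    moreover have "yamanouchi d (word U)" using U by (simp add: Y_def)
    ultimately show ?thesis
      using yamanouchi_content_mono[of d "word U"] by (auto simp: partitions_def)
  qed
  have "structure_const d la mu = c"
  proof (rule structure_const_eqI)
    show "finite {nu. c nu \<noteq> 0}" using finite_subset[OF V] finY by simp
    show "{nu. c nu \<noteq> 0} \<subseteq> partitions d" using V part by blast
    have schur: "factorial_schur d mu = M.schur Var"
      by (simp add: factorial_schur_def M.schur_def M.factor_def y_var_def case_prod_unfold)
    have alt: "alternant_of d la = antisymmetrize d (M.monom (M.exponent w0)) Var"
      by (simp add: alternant_of_def M.exponent_def[abs_def] w0)
    have "alternant_of d la * factorial_schur d mu =
        (\<Sum>U\<in>Y. Const (weight d la mu (T0, U)) * alternant_of d (content (word U)))"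
      unfolding schur alt M.bar_expansion[OF w0(1)] Y_def word_def Const_weight
      by (simp add: alternant_of_def M.exponent_def[abs_def])
    \<comment> \<open>Grouping the fillings by content turns the sum over tableaux into an expansion
      indexed by partitions.\<close>
    also have "\<dots> = (\<Sum>nu\<in>?V. \<Sum>U | U \<in> Y \<and> content (word U) = nu.
        Const (weight d la mu (T0, U)) * alternant_of d (content (word U)))"
      by (rule sum.image_gen[OF finY])
    also have "\<dots> = (\<Sum>nu\<in>?V. Const (c nu) * alternant_of d nu)"
      by (intro sum.cong refl) (simp add: c Const_sum sum_distrib_right)
    also have "\<dots> = (\<Sum>nu | c nu \<noteq> 0. Const (c nu) * alternant_of d nu)"
      using V finY by (intro sum.mono_neutral_right) auto
    finally show "alternant_of d la * factorial_schur d mu = (\<Sum>nu | c nu \<noteq> 0. Const (c nu) * alternant_of d nu)" .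
  qed (rule assms)
  then show ?thesis by (simp add: c_def)
qed

end
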